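(* Assume the game and the gradient noise satisfy the standing assumptions (i)–(vi) given in the context, with strong monotonicity modulus $\mu$ and moment exponent $\delta\in(1,2]$. Consider the median-of-means algorithm described in the context with step sizes $\alpha_k=b(k+1)^{-1}$ for some $b>0$, and sample sizes $m_k=c\lceil(k+1)^\beta\rceil$ with any $\beta>0$ and integer $c\ge1$, where $b$ is selected such that $$\mu b>\max\Big\{1,\ \beta\cdot\frac{2(\delta-1)}{\delta}\Big\}.$$ Let the block parameters be $$b_k=\Big\lfloor \min\big\{8\ln(e^{1/8}\gamma_k^{-1}),\ \tfrac{m_k}{2}\big\}\Big\rfloor,\qquad s_k=\Big\lfloor \frac{m_k}{b_k}\Big\rfloor,\qquad \gamma_k=\frac{1}{(k+1)^2}.$$ Then for almost every sample path $\omega$ there exist a constant $A_3(\omega)>0$ and an integer $K_r(\omega)$ such that for all $k\ge K_r(\omega)$, $$\|\mathbf{x}_k-x^*\|^2\le A_3(\omega)\max\left\{\frac1k,\ \left(\frac{\ln k}{k^\beta}\right)^{\frac{2(\delta-1)}{\delta}}\right\},$$ where $x^*$ is the unique Nash equilibrium. In particular, when $\delta=2$ and $\beta\ge1$, for all $k\ge K_r(\omega)$, $$\|\mathbf{x}_k-x^*\|^2\le A_3(\omega)\frac{\ln k}{k}.$$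
   Context: **Game.** There are $N>1$ players. Player $i\in\{1,\dots,N\}$ chooses $x_i\in\Omega_i\subseteq\mathbb{R}$ to minimize $J_i(x_i,x_{-i}):=\mathbb{E}_{\xi_i}[f_i(x_i,x_{-i},\xi_i)]$, where $x_{-i}\in\Omega_{-i}:=\prod_{j\ne i}\Omega_j$ is the vector of the other players' actions and $\xi_i$ is a real random variable. Write $J_i(x)=J_i(x_i,x_{-i})$ and $\Omega=\Omega_1\times\cdots\times\Omega_N$; $f_i$ and $J_i$ are defined on an open set containing $\Omega$ in the variable $x$, so that the derivatives below make sense on $\Omega$. A Nash equilibrium is $x^*\in\Omega$ with $J_i(x_i^*,x_{-i}^* )\le J_i(x_i,x_{-i}^* )$ for all $x_i\in\Omega_i$ and all $i$. $\|\cdot\|$ is the Euclidean norm and $\mathbb{P}_{\Omega_i}[\cdot]$ is Euclidean projection onto $\Omega_i$. The pseudo-gradient is $F(x):=[\nabla_{x_1}J_1(x),\dots,\nabla_{x_N}J_N(x)]^\top\in\mathbb{R}^N$. **Algorithm.** Start from $\mathbf{x}_0\in\Omega$. At step $k=0,1,2,\dots$, with $\mathbf{x}_k=[x_{1,k},\dots,x_{N,k}]^\top$, each player $i$: (1) draws $m_k$ i.i.d. samples $\xi_{i,k}^1,\dots,\xi_{i,k}^{m_k}$ of $\xi_i$, independent of the past, and computes $g_{i,k}^j=\nabla_{x_i}f_i(\mathbf{x}_k,\xi_{i,k}^j)$; (2) forms $b_k$ disjoint blocks $B_1,\dots,B_{b_k}$ of sample indices, each of size $s_k$ (leftover samples are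 unused), and computes $\bar g_{i,k}^\ell=\frac1{s_k}\sum_{j\in B_\ell}g_{i,k}^j$; (3) computes $\hat g_{i,k}=\operatorname{median}\{\bar g_{i,k}^1,\dots,\bar g_{i,k}^{b_k}\}$ (the average of the two middle values if $b_k$ is even); (4) sets $x_{i,k+1}=\mathbb{P}_{\Omega_i}[x_{i,k}-\alpha_k\hat g_{i,k}]$. If the formula for $b_k$ gives $0$ (which happens only when $m_k=1$, i.e. $k=0$, $c=1$), take $b_k=s_k=1$. **Standing assumptions.** Let $\mathcal{F}_k$ be the $\sigma$-algebra containing all randomness up to step $k-1$ (so $\mathbf{x}_k$ is $\mathcal{F}_k$-measurable), and let $\epsilon_{i,k}^j=g_{i,k}^j-\nabla_{x_i}J_i(\mathbf{x}_k)$. (i) $\Omega$ is nonempty, convex and compact. (ii) Each $J_i$ is continuously differentiable, and convex in $x_i$ for every fixed $x_{-i}\in\Omega_{-i}$. (iii) $F$ is strongly monotone with modulus $\mu>0$: $(F(x)-F(y))^\top(x-y)\ge\mu\|x-y\|^2$ for all $x,y\in\Omega$. (iv) $F$ is $L$-Lipschitz for some $L>0$: $\|F(x)-F(y)\|\le L\|x-y\|$ for all $x,y\in\Omega$. (v) For all $i$, $k\ge0$, $j$: $\mathbb{E}[\epsilon_{i,k}^j\mid\mathcal{F}_k]=0$ a.s. (vi) There exist $1<\delta\le2$ and $\nu>0$ with $\mathbb{E}[|\epsilon_{i,k}^j|^\delta\mid\mathcal{F}_k]\le\nu^\delta$ a.s. for all $i,k,j$. Under (i)–(iii) there is a unique Nash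 equilibrium $x^*$. *)

theory Defs
  imports "HOL-Probability.Probability"
begin

definition replace_coord :: "real^'n \<Rightarrow> 'n \<Rightarrow> real \<Rightarrow> real^'n" where
  "replace_coord x i t = (\<chi> j. if j = i then t else x $ j)"

text \<open>Since \<^const>\<open>deriv\<close> is a choice operator, this value is meaningful only where the
  partial derivative exists.\<close>

definition partial_deriv :: "'n \<Rightarrow> (real^'n \<Rightarrow> real) \<Rightarrow> real^'n \<Rightarrow> real" where
  "partial_deriv i h x = deriv (\<lambda>t. h (replace_coord x i t)) (x $ i)"

definition pseudo_gradient :: "('n \<Rightarrow> real^'n \<Rightarrow> real) \<Rightarrow> real^'n \<Rightarrow> real^'n" where
  "pseudo_gradient J x = (\<chi> i. partial_deriv i (J i) x)"

definition strategy_space :: "('n \<Rightarrow> real set) \<Rightarrow> (real^'n) set" where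
  "strategy_space S = {x. \<forall>i. x $ i \<in> S i}"

definition nash_equilibrium ::
  "('n \<Rightarrow> real set) \<Rightarrow> ('n \<Rightarrow> real^'n \<Rightarrow> real) \<Rightarrow> real^'n \<Rightarrow> bool" where
  "nash_equilibrium S J x \<longleftrightarrow>
     x \<in> strategy_space S \<and> (\<forall>i. \<forall>t\<in>S i. J i x \<le> J i (replace_coord x i t))"

text \<open>A list is used, rather than a set, so that repeated values are counted with multiplicity.\<close>

definition median :: "real list \<Rightarrow> real" where
  "median xs =
     (let ys = sort xs; n = length xs
      in if odd n then ys ! (n div 2) else (ys ! (n div 2 - 1) + ys ! (n div 2)) / 2)"

text \<open>The information available before the samples of step \<open>k\<close> are drawn: it is generated by the
  initial point and by the samples \<open>X i l j\<close> (player \<open>i\<close>, step \<open>l\<close>, index \<open>j\<close>) of all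
  players at the steps \<open>l < k\<close>.\<close>

definition past ::
  "'w measure \<Rightarrow> ('w \<Rightarrow> real^'n) \<Rightarrow> (nat \<Rightarrow> nat) \<Rightarrow> ('n \<Rightarrow> nat \<Rightarrow> nat \<Rightarrow> 'w \<Rightarrow> real) \<Rightarrow> nat \<Rightarrow> 'w measure" where
  "past M x0 m X k = sigma (space M)
     ({x0 -` A \<inter> space M | A. A \<in> sets borel} \<union>
      {X i l j -` A \<inter> space M | i l j A. l < k \<and> j \<in> {1..m l} \<and> A \<in> sets borel})"

definition step_samples ::
  "'w measure \<Rightarrow> (nat \<Rightarrow> nat) \<Rightarrow> ('n \<Rightarrow> nat \<Rightarrow> nat \<Rightarrow> 'w \<Rightarrow> real) \<Rightarrow> 'n \<Rightarrow> nat \<Rightarrow> 'w measure" where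
  "step_samples M m X i k = sigma (space M)
     {X i k j -` A \<inter> space M | j A. j \<in> {1..m k} \<and> A \<in> sets borel}"

end

theory Submission
  imports Defs "HOL-Real_Asymp.Real_Asymp"
begin

text \<open>
  Write \<open>r k\<close> for the distance from the \<open>k\<close>-th iterate to the equilibrium \<open>xs\<close>, \<open>F\<close> for the
  pseudo-gradient, and \<open>p = (\<delta> - 1) / \<delta>\<close>. The argument separates a deterministic recursion for
  \<open>r\<close> from a probabilistic bound on the estimation error \<open>e k\<close> of the gradient.

  The equilibrium solves the variational inequality of \<open>F\<close> (lemma
  \<open>nash_equilibrium_iff_solves_vi\<close>), hence is a fixed point of every exact projected gradient
  step. Projection is nonexpansive, and strong monotonicity together with Lipschitz continuity makes
  a short gradient step a contraction, so
  \<open>r (k + 1) \<le> (1 - \<mu> * \<alpha> k + L^2 * (\<alpha> k)^2 / 2) * r k + \<alpha> k * norm (e k)\<close> as soon as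
  \<open>\<mu> * \<alpha> k \<le> 1\<close> (lemma \<open>projected_noisy_gradient_step\<close>). With \<open>\<alpha> k = b / (k + 1)\<close> the contraction
  removes, to leading order, the fraction \<open>\<mu> * b / (k + 1)\<close> of \<open>r k\<close> at each step, whereas a noise level
  \<open>(ln k / k powr \<beta>) powr p\<close> shrinks by a fraction of at most \<open>p * \<beta> / k\<close>. As \<open>\<mu> * b > p * \<beta>\<close>,
  the distance inherits the rate of the noise (lemma \<open>perturbed_linear_recursion_rate\<close>), and its
  square is at most of the order of the second entry of the maximum in the theorem.

  It remains to see that almost surely \<open>norm (e k)\<close> is eventually at most of the order
  \<open>(ln k / k powr \<beta>) powr p\<close>. The samples of step \<open>k\<close> are independent of the past, so the past, and
  with it the iterate, may be treated as a constant: for almost every frozen past the gradient errors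
  are independent, centred, and have \<open>\<delta>\<close>-th moment at most \<open>\<nu> powr \<delta>\<close>
  (lemmas \<open>nn_cond_exp_freeze\<close> and \<open>frozen_noise_moments\<close>). A moment inequality of von Bahr and
  Esseen type (lemma \<open>moment_indep_sum_le\<close>) and Markov's inequality show that one block mean of
  \<open>s\<close> samples errs by more than a multiple of \<open>s powr - p\<close> with probability at most \<open>1/8\<close>. The
  median can err by that much only if at least half of the \<open>n\<close> blocks do; a union bound over the
  sets of erring blocks gives probability at most \<open>2^n * (1/8) powr (n/2) = (1/2) powr (n/2)\<close>
  (lemma \<open>median_of_means_failure\<close>). The number of blocks is at least \<open>16 * ln (k + 1)\<close> for large
  \<open>k\<close>, so these probabilities are summable and the Borel-Cantelli lemma applies. The block size is at
  least \<open>k powr \<beta> / (66 * ln k)\<close> for large \<open>k\<close>, which turns \<open>s powr - p\<close> into the required rate.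

  Existence of the equilibrium comes from Banach's fixed point theorem applied to an exact projected
  step, and uniqueness from strong monotonicity.
\<close>

section \<open>The median of a list\<close>

lemma sorted_nth_le_iff_filter:
  fixes ys :: "'a::linorder list"
  assumes "sorted ys" "r < length ys"
  shows "ys ! r \<le> a \<longleftrightarrow> r < length (filter (\<lambda>x. x \<le> a) ys)"
  using assms
proof (induction ys arbitrary: r)
  case Nil
  then show ?case by simp
next
  case (Cons y ys)
  show ?case
  proof (cases "y \<le> a")
    case True
    then show ?thesis
      using Cons by (cases r) auto
  next
    case False
    have "\<forall>z\<in>set ys. y \<le> z"
      using Cons.prems by simp
    then have "filter (\<lambda>x. x \<le> a) (y # ys) = []"
      using False by (auto simp: filter_empty_conv)
    moreover have "(y # ys) ! r \<in> set (y # ys)"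
      using Cons.prems(2) by (rule nth_mem)
    ultimately show ?thesis
      using False \<open>\<forall>z\<in>set ys. y \<le> z\<close> by auto
  qed
qed

text \<open>
  Order statistics are governed by counts. This turns statements about the median into statements
  about the number of entries on either side of a threshold.
\<close>

lemma sort_nth_le_iff_filter:
  fixes xs :: "'a::linorder list"
  assumes "r < length xs"
  shows "sort xs ! r \<le> a \<longleftrightarrow> r < length (filter (\<lambda>x. x \<le> a) xs)"
proof -
  have "length (filter (\<lambda>x. x \<le> a) (sort xs)) = length (filter (\<lambda>x. x \<le> a) xs)"
    by (metis filter_sort length_sort)
  then show ?thesis
    using sorted_nth_le_iff_filter[of "sort xs" r a] assms by simp
qed

text \<open>
  The counting criterion expresses a sublevel set of an order statistic through the number of
  entries below the level, which is a measurable quantity.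
\<close>

lemma borel_measurable_sort_nth:
  fixes h :: "'l \<Rightarrow> 'w \<Rightarrow> real"
  assumes "\<And>l. l \<in> set ls \<Longrightarrow> h l \<in> borel_measurable N" and r: "r < length ls"
  shows "(\<lambda>\<omega>. sort (map (\<lambda>l. h l \<omega>) ls) ! r) \<in> borel_measurable N"
proof (subst borel_measurable_iff_le, rule allI)
  fix a
  have count: "(\<lambda>\<omega>. length (filter (\<lambda>x. x \<le> a) (map (\<lambda>l. h l \<omega>) ls))) \<in> measurable N (count_space UNIV)"
    using assms(1)
  proof (induction ls)
    case Nil
    then show ?case by simp
  next
    case (Cons l ls)
    have [measurable]: "h l \<in> borel_measurable N"
      "(\<lambda>\<omega>. length (filter (\<lambda>x. x \<le> a) (map (\<lambda>l. h l \<omega>) ls))) \<in> measurable N (count_space UNIV)"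
      using Cons by auto
    have "(\<lambda>\<omega>. length (filter (\<lambda>x. x \<le> a) (map (\<lambda>l. h l \<omega>) (l # ls)))) =
       (\<lambda>\<omega>. (if h l \<omega> \<le> a then Suc else id) (length (filter (\<lambda>x. x \<le> a) (map (\<lambda>l. h l \<omega>) ls))))"
      by auto
    also have "\<dots> = (\<lambda>\<omega>. if h l \<omega> \<le> a then Suc (length (filter (\<lambda>x. x \<le> a) (map (\<lambda>l. h l \<omega>) ls)))
        else length (filter (\<lambda>x. x \<le> a) (map (\<lambda>l. h l \<omega>) ls)))"
      by auto
    also have "\<dots> \<in> measurable N (count_space UNIV)"
      by measurable
    finally show ?case .
  qed
  have "{\<omega> \<in> space N. sort (map (\<lambda>l. h l \<omega>) ls) ! r \<le> a} =
     {\<omega> \<in> space N. r < length (filter (\<lambda>x. x \<le> a) (map (\<lambda>l. h l \<omega>) ls))}"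
    using r by (simp add: sort_nth_le_iff_filter)
  also have "\<dots> = (\<lambda>\<omega>. length (filter (\<lambda>x. x \<le> a) (map (\<lambda>l. h l \<omega>) ls))) -` {r<..} \<inter> space N"
    by auto
  also have "\<dots> \<in> sets N"
    by (rule measurable_sets[OF count]) simp
  finally show "{\<omega> \<in> space N. sort (map (\<lambda>l. h l \<omega>) ls) ! r \<le> a} \<in> sets N" .
qed

lemma borel_measurable_median:
  fixes h :: "'l \<Rightarrow> 'w \<Rightarrow> real"
  assumes "\<And>l. l \<in> set ls \<Longrightarrow> h l \<in> borel_measurable N" and "ls \<noteq> []"
  shows "(\<lambda>\<omega>. median (map (\<lambda>l. h l \<omega>) ls)) \<in> borel_measurable N"
proof -
  have "length ls > 0"
    using assms(2) by simp
  then have [measurable]: "(\<lambda>\<omega>. sort (map (\<lambda>l. h l \<omega>) ls) ! (length ls div 2)) \<in> borel_measurable N"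
    "(\<lambda>\<omega>. sort (map (\<lambda>l. h l \<omega>) ls) ! (length ls div 2 - 1)) \<in> borel_measurable N"
    by (auto intro!: borel_measurable_sort_nth assms(1) less_imp_diff_less)
  show ?thesis
    unfolding median_def Let_def length_map by (cases "odd (length ls)") (simp_all del: One_nat_def)
qed

text \<open>
  A middle order statistic outside the interval of radius \<open>\<eta>\<close> around \<open>a\<close> would take at least half
  of the entries with it. For an even number of entries this is needed for both middle ones.
\<close>

lemma median_near:
  fixes xs :: "real list"
  assumes few: "2 * length (filter (\<lambda>x. \<eta> < \<bar>x - a\<bar>) xs) < length xs"
  shows "\<bar>median xs - a\<bar> \<le> \<eta>"
proof -
  define n where "n = length xs"
  have near: "\<bar>sort xs ! r - a\<bar> \<le> \<eta>" if r: "n \<le> 2 * r + 2" "2 * r \<le> n" "r < n" for r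
  proof -
    have mono: "length (filter P xs) \<le> length (filter Q xs)" if "\<And>x. P x \<Longrightarrow> Q x" for P Q
      using that by (induction xs) auto
    have "length xs = length (filter (\<lambda>x. x \<le> a + \<eta>) xs) + length (filter (\<lambda>x. \<not> x \<le> a + \<eta>) xs)"
      by (rule sum_length_filter_compl[symmetric])
    moreover have "length (filter (\<lambda>x. \<not> x \<le> a + \<eta>) xs) \<le> length (filter (\<lambda>x. \<eta> < \<bar>x - a\<bar>) xs)"
      by (rule mono) auto
    ultimately have "r < length (filter (\<lambda>x. x \<le> a + \<eta>) xs)"
      using few r n_def by linarith
    then have up: "sort xs ! r \<le> a + \<eta>"
      using sort_nth_le_iff_filter[of r xs] r n_def by simp
    have "a - \<eta> \<le> sort xs ! r"
    proof (rule ccontr)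
      assume low: "\<not> a - \<eta> \<le> sort xs ! r"
      have "r < length (filter (\<lambda>x. x \<le> sort xs ! r) xs)"
        using sort_nth_le_iff_filter[of r xs "sort xs ! r"] r n_def by simp
      moreover have "length (filter (\<lambda>x. x \<le> sort xs ! r) xs) \<le> length (filter (\<lambda>x. \<eta> < \<bar>x - a\<bar>) xs)"
        by (rule mono) (use low in auto)
      ultimately show False
        using few r n_def by linarith
    qed
    then show ?thesis
      using up by linarith
  qed
  have "n > 0"
    using few n_def by auto
  show ?thesis
  proof (cases "odd n")
    case True
    then have "\<bar>sort xs ! (n div 2) - a\<bar> \<le> \<eta>"
      using near[of "n div 2"] \<open>n > 0\<close> by auto
    then show ?thesis
      using True by (simp add: median_def n_def)
  next
    case False
    then have "n \<ge> 2"
      using \<open>n > 0\<close> by (cases "n = 1") auto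
    then have "\<bar>sort xs ! (n div 2) - a\<bar> \<le> \<eta>" "\<bar>sort xs ! (n div 2 - 1) - a\<bar> \<le> \<eta>"
      using near[of "n div 2"] near[of "n div 2 - 1"] False by auto
    then have "\<bar>(sort xs ! (n div 2 - 1) + sort xs ! (n div 2)) / 2 - a\<bar> \<le> \<eta>"
      by (simp add: abs_le_iff field_simps)
    then show ?thesis
      using False by (simp add: median_def n_def Let_def)
  qed
qed

section \<open>Median of means for independent samples\<close>

lemma powr_subadditive:
  fixes a b p :: real
  assumes "a \<ge> 0" "b \<ge> 0" "p \<le> 1"
  shows "(a + b) powr p \<le> a powr p + b powr p"
proof (cases "a = 0 \<or> b = 0")
  case True
  then show ?thesis by auto
next
  case False
  then have ab: "a > 0" "b > 0"
    using assms by auto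
  have "(a + b) powr p = (a + b) * (a + b) powr (p - 1)"
    using ab by (simp add: powr_mult_base)
  also have "\<dots> = a * (a + b) powr (p - 1) + b * (a + b) powr (p - 1)"
    by (simp add: distrib_right)
  also have "\<dots> \<le> a * a powr (p - 1) + b * b powr (p - 1)"
    using ab assms(3) by (intro add_mono mult_left_mono powr_mono2') auto
  also have "\<dots> = a powr p + b powr p"
    using ab by (simp add: powr_mult_base)
  finally show ?thesis .
qed

lemma abs_powr_diff_le:
  fixes x y p :: real
  assumes "x \<ge> 0" "y \<ge> 0" "0 < p" "p \<le> 1"
  shows "\<bar>x powr p - y powr p\<bar> \<le> \<bar>x - y\<bar> powr p"
proof -
  have *: "u powr p - v powr p \<le> \<bar>u - v\<bar> powr p" if "u \<ge> 0" "v \<ge> 0" for u v :: real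
  proof (cases "u \<le> v")
    case True
    then have "u powr p \<le> v powr p"
      using that assms by (intro powr_mono2) auto
    then show ?thesis
      by (smt (verit) powr_ge_zero)
  next
    case False
    then show ?thesis
      using powr_subadditive[of v "u - v" p] that assms by simp
  qed
  show ?thesis
    using *[of x y] *[of y x] assms by (simp add: abs_minus_commute abs_le_iff)
qed

text \<open>
  For \<open>p = \<delta> - 1\<close> the function \<open>\<lambda>u. sgn u * \<bar>u\<bar> powr p\<close> is, up to the factor \<open>\<delta>\<close>, the derivative
  of \<open>\<lambda>u. \<bar>u\<bar> powr \<delta>\<close>. Its Hoelder continuity controls the remainder of a first-order expansion, although
  the second derivative is unbounded near \<open>0\<close> when \<open>\<delta> < 2\<close>.
\<close>

lemma signed_powr_holder:
  fixes x y p :: real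
  assumes "0 < p" "p \<le> 1"
  shows "\<bar>sgn x * \<bar>x\<bar> powr p - sgn y * \<bar>y\<bar> powr p\<bar> \<le> 2 * \<bar>x - y\<bar> powr p"
proof -
  have same: "\<bar>\<bar>x\<bar> powr p - \<bar>y\<bar> powr p\<bar> \<le> \<bar>\<bar>x\<bar> - \<bar>y\<bar>\<bar> powr p"
    by (rule abs_powr_diff_le) (use assms in auto)
  have double: "\<bar>x - y\<bar> powr p \<le> 2 * \<bar>x - y\<bar> powr p"
    by simp
  consider "x \<ge> 0" "y \<ge> 0" | "x \<le> 0" "y \<le> 0" | "x > 0" "y < 0" | "x < 0" "y > 0"
    by linarith
  then show ?thesis
  proof cases
    case 1
    then have eqs: "sgn x * \<bar>x\<bar> powr p = x powr p" "sgn y * \<bar>y\<bar> powr p = y powr p"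
      by (auto simp: sgn_if)
    have "\<bar>x powr p - y powr p\<bar> \<le> \<bar>x - y\<bar> powr p"
      using same 1 by simp
    then show ?thesis
      unfolding eqs using double by (rule order_trans)
  next
    case 2
    then have eqs: "sgn x * \<bar>x\<bar> powr p = - (\<bar>x\<bar> powr p)" "sgn y * \<bar>y\<bar> powr p = - (\<bar>y\<bar> powr p)"
      by (auto simp: sgn_if)
    have "\<bar>- (\<bar>x\<bar> powr p) - - (\<bar>y\<bar> powr p)\<bar> \<le> \<bar>x - y\<bar> powr p"
      using same 2 by (simp add: abs_minus_commute)
    then show ?thesis
      unfolding eqs using double by (rule order_trans)
  next
    case 3
    have eq: "sgn x * \<bar>x\<bar> powr p - sgn y * \<bar>y\<bar> powr p = \<bar>x\<bar> powr p + \<bar>y\<bar> powr p"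
      using 3 by simp
    have "\<bar>x\<bar> powr p \<le> \<bar>x - y\<bar> powr p" "\<bar>y\<bar> powr p \<le> \<bar>x - y\<bar> powr p"
      using assms 3 by (auto intro!: powr_mono2)
    then show ?thesis
      unfolding eq by simp
  next
    case 4
    have eq: "sgn x * \<bar>x\<bar> powr p - sgn y * \<bar>y\<bar> powr p = - (\<bar>x\<bar> powr p + \<bar>y\<bar> powr p)"
      using 4 by simp
    have "\<bar>x\<bar> powr p \<le> \<bar>x - y\<bar> powr p" "\<bar>y\<bar> powr p \<le> \<bar>x - y\<bar> powr p"
      using assms 4 by (auto intro!: powr_mono2)
    then show ?thesis
      unfolding eq abs_minus_cancel by simp
  qed
qed

lemma DERIV_abs_powr:
  fixes x \<delta> :: real
  assumes "\<delta> > 1"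
  shows "((\<lambda>t. \<bar>t\<bar> powr \<delta>) has_real_derivative \<delta> * (sgn x * \<bar>x\<bar> powr (\<delta> - 1))) (at x)"
proof -
  consider "x > 0" | "x < 0" | "x = 0"
    by linarith
  then show ?thesis
  proof cases
    case 1
    have "((\<lambda>t. t powr \<delta>) has_real_derivative \<delta> * x powr (\<delta> - 1)) (at x)"
      using 1 by (rule has_real_derivative_powr)
    then have "((\<lambda>t. \<bar>t\<bar> powr \<delta>) has_real_derivative \<delta> * x powr (\<delta> - 1)) (at x)"
      by (rule has_field_derivative_transform_within[where d = x]) (use 1 in \<open>auto simp: dist_real_def\<close>)
    then show ?thesis
      using 1 by simp
  next
    case 2
    have "((\<lambda>t. (- t) powr \<delta>) has_real_derivative - (\<delta> * (- x) powr (\<delta> - 1))) (at x)"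
      using 2 by (auto intro!: derivative_eq_intros simp: powr_diff)
    then have "((\<lambda>t. \<bar>t\<bar> powr \<delta>) has_real_derivative - (\<delta> * (- x) powr (\<delta> - 1))) (at x)"
      by (rule has_field_derivative_transform_within[where d = "- x"]) (use 2 in \<open>auto simp: dist_real_def\<close>)
    then show ?thesis
      using 2 by simp
  next
    case 3
    have "(\<lambda>h. \<bar>h\<bar> powr (\<delta> - 1)) \<midarrow>0::real\<rightarrow> 0"
      by (rule tendsto_zero_powrI[where b = "\<delta> - 1"]) (use assms in \<open>auto intro!: tendsto_eq_intros\<close>)
    then have "(\<lambda>h. \<bar>h\<bar> powr \<delta> / h) \<midarrow>0::real\<rightarrow> 0"
    proof (rule tendsto_0_le[where K = 1])
      have "norm (\<bar>h\<bar> powr \<delta> / h) \<le> norm (\<bar>h\<bar> powr (\<delta> - 1)) * 1" if "h \<noteq> 0" for h :: real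
        using that by (simp add: powr_diff abs_mult)
      then show "\<forall>\<^sub>F h in at (0::real). norm (\<bar>h\<bar> powr \<delta> / h) \<le> norm (\<bar>h\<bar> powr (\<delta> - 1)) * 1"
        by (auto simp: eventually_at_filter)
    qed
    then show ?thesis
      using 3 by (simp add: has_field_derivative_iff)
  qed
qed

text \<open>
  The mean value theorem gives the increment as \<open>b\<close> times the derivative at an intermediate point,
  and Hoelder continuity replaces that point by \<open>a\<close> at the cost of a multiple of \<open>\<bar>b\<bar> powr \<delta>\<close>. The
  term linear in \<open>b\<close> is kept exactly, because it vanishes in expectation when \<open>b\<close> is centred and
  independent of \<open>a\<close>.
\<close>

lemma abs_powr_add_le:
  fixes a b \<delta> :: real
  assumes "1 < \<delta>" "\<delta> \<le> 2"
  shows "\<bar>a + b\<bar> powr \<delta> \<le> \<bar>a\<bar> powr \<delta> + \<delta> * ((sgn a * \<bar>a\<bar> powr (\<delta> - 1)) * b) + 4 * \<bar>b\<bar> powr \<delta>"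
proof -
  let ?h = "\<lambda>u::real. sgn u * \<bar>u\<bar> powr (\<delta> - 1)"
  have "\<exists>z>0. z < 1 \<and> \<bar>a + 1 * b\<bar> powr \<delta> - \<bar>a + 0 * b\<bar> powr \<delta> = (1 - 0) * (\<delta> * ?h (a + z * b) * b)"
  proof (rule MVT2)
    fix t :: real
    have *: "((\<lambda>t. a + t * b) has_real_derivative b) (at t)"
      by (auto intro!: derivative_eq_intros)
    show "((\<lambda>t. \<bar>a + t * b\<bar> powr \<delta>) has_real_derivative \<delta> * ?h (a + t * b) * b) (at t)"
      using DERIV_chain2[OF DERIV_abs_powr[OF assms(1)] *] by simp
  qed simp
  then obtain z where z: "z > 0" "z < 1"
    "\<bar>a + b\<bar> powr \<delta> - \<bar>a\<bar> powr \<delta> = \<delta> * ?h (a + z * b) * b"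
    by auto
  have "\<bar>?h (a + z * b) - ?h a\<bar> \<le> 2 * \<bar>z * b\<bar> powr (\<delta> - 1)"
    using signed_powr_holder[of "\<delta> - 1" "a + z * b" a] assms by simp
  also have "\<dots> \<le> 2 * \<bar>b\<bar> powr (\<delta> - 1)"
    using z assms by (auto intro!: powr_mono2 simp: abs_mult mult_left_le_one_le)
  finally have "\<bar>?h (a + z * b) - ?h a\<bar> * (\<delta> * \<bar>b\<bar>) \<le> 2 * \<bar>b\<bar> powr (\<delta> - 1) * (\<delta> * \<bar>b\<bar>)"
    using assms by (intro mult_right_mono) auto
  also have "\<dots> = 2 * \<delta> * \<bar>b\<bar> powr \<delta>"
    by (cases "b = 0") (auto simp: powr_diff)
  also have "\<dots> \<le> 4 * \<bar>b\<bar> powr \<delta>"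
    using assms by (intro mult_right_mono) auto
  finally have "\<bar>(?h (a + z * b) - ?h a) * (\<delta> * b)\<bar> \<le> 4 * \<bar>b\<bar> powr \<delta>"
    using assms by (simp add: abs_mult)
  then have "(?h (a + z * b) - ?h a) * (\<delta> * b) \<le> 4 * \<bar>b\<bar> powr \<delta>"
    by linarith
  then show ?thesis
    using z(3) by (simp add: algebra_simps)
qed

context prob_space begin

lemma integrable_lower_powr:
  fixes Y :: "'a \<Rightarrow> real"
  assumes [measurable]: "Y \<in> borel_measurable M"
    and int: "integrable M (\<lambda>\<omega>. \<bar>Y \<omega>\<bar> powr \<delta>)" and p: "0 < p" "p \<le> \<delta>"
  shows "integrable M (\<lambda>\<omega>. \<bar>Y \<omega>\<bar> powr p)"
proof (rule Bochner_Integration.integrable_bound)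
  show "integrable M (\<lambda>\<omega>. 1 + \<bar>Y \<omega>\<bar> powr \<delta>)"
    using int by simp
  have "\<bar>t\<bar> powr p \<le> 1 + \<bar>t\<bar> powr \<delta>" for t :: real
  proof (cases "\<bar>t\<bar> \<le> 1")
    case True
    then have "\<bar>t\<bar> powr p \<le> 1 powr p"
      using p by (intro powr_mono2) auto
    then show ?thesis
      by (smt (verit) powr_one_eq_one powr_ge_zero)
  next
    case False
    then have "\<bar>t\<bar> powr p \<le> \<bar>t\<bar> powr \<delta>"
      using p by (intro powr_mono) auto
    then show ?thesis by simp
  qed
  then show "AE \<omega> in M. norm (\<bar>Y \<omega>\<bar> powr p) \<le> norm (1 + \<bar>Y \<omega>\<bar> powr \<delta>)"
    by (smt (verit) AE_I2 real_norm_def powr_ge_zero)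
qed simp

lemma integrable_if_higher_moment:
  fixes Y :: "'a \<Rightarrow> real"
  assumes [measurable]: "Y \<in> borel_measurable M"
    and int: "integrable M (\<lambda>\<omega>. \<bar>Y \<omega>\<bar> powr \<delta>)" and "1 \<le> \<delta>"
  shows "integrable M Y"
proof -
  have "integrable M (\<lambda>\<omega>. \<bar>Y \<omega>\<bar> powr 1)"
    using assms by (intro integrable_lower_powr[OF _ int]) auto
  then show ?thesis
    by (simp add: integrable_abs_iff)
qed

text \<open>
  An inequality of von Bahr and Esseen type. Adding an independent centred summand costs only four
  times its own moment: the linear term of \<open>abs_powr_add_le\<close> has expectation zero. For \<open>\<delta> = 2\<close> and up to
  the factor this is the additivity of variances.
\<close>

lemma moment_indep_sum_le:
  fixes X :: "'i \<Rightarrow> 'a \<Rightarrow> real" and \<delta> v :: real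
  assumes \<delta>: "1 < \<delta>" "\<delta> \<le> 2" and "finite I"
    and indep: "indep_vars (\<lambda>_. borel) X I"
    and int: "\<And>i. i \<in> I \<Longrightarrow> integrable M (\<lambda>\<omega>. \<bar>X i \<omega>\<bar> powr \<delta>)"
    and moment: "\<And>i. i \<in> I \<Longrightarrow> expectation (\<lambda>\<omega>. \<bar>X i \<omega>\<bar> powr \<delta>) \<le> v"
    and centered: "\<And>i. i \<in> I \<Longrightarrow> expectation (X i) = 0"
  shows "integrable M (\<lambda>\<omega>. \<bar>\<Sum>i\<in>I. X i \<omega>\<bar> powr \<delta>) \<and>
    expectation (\<lambda>\<omega>. \<bar>\<Sum>i\<in>I. X i \<omega>\<bar> powr \<delta>) \<le> 4 * real (card I) * v"
  using \<open>finite I\<close> indep int moment centered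
proof (induction I rule: finite_induct)
  case empty
  then show ?case by simp
next
  case (insert i I)
  define S where "S = (\<lambda>\<omega>. \<Sum>i\<in>I. X i \<omega>)"
  have IH: "integrable M (\<lambda>\<omega>. \<bar>S \<omega>\<bar> powr \<delta>)" "expectation (\<lambda>\<omega>. \<bar>S \<omega>\<bar> powr \<delta>) \<le> 4 * real (card I) * v"
    using insert.IH insert.prems indep_vars_subset[OF insert.prems(1), of I] by (auto simp: S_def)
  have indep: "indep_var borel (X i) borel S"
    unfolding S_def using insert by (intro indep_vars_sum) auto
  then have [measurable]: "X i \<in> borel_measurable M" "S \<in> borel_measurable M"
    by (auto dest: indep_var_rv1 indep_var_rv2)
  define h where "h = (\<lambda>u::real. sgn u * \<bar>u\<bar> powr (\<delta> - 1))"
  have [measurable]: "h \<in> borel_measurable borel"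
    unfolding h_def by measurable
  have "indep_var borel (id \<circ> X i) borel (h \<circ> S)"
    by (intro indep_var_compose[OF indep]) auto
  then have indep': "indep_var borel (X i) borel (\<lambda>\<omega>. h (S \<omega>))"
    by (simp add: comp_def)
  have intX: "integrable M (X i)"
    using \<delta> by (intro integrable_if_higher_moment[OF _ insert.prems(2)[OF insertI1]]) auto
  have "integrable M (\<lambda>\<omega>. \<bar>S \<omega>\<bar> powr (\<delta> - 1))"
    using \<delta> by (intro integrable_lower_powr[OF _ IH(1)]) auto
  then have "integrable M (\<lambda>\<omega>. \<bar>h (S \<omega>)\<bar>)"
    by (rule Bochner_Integration.integrable_bound) (auto simp: h_def abs_mult sgn_if)
  then have inth: "integrable M (\<lambda>\<omega>. h (S \<omega>))"
    by (simp add: integrable_abs_iff)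
  have commute: "(\<lambda>\<omega>. X i \<omega> * h (S \<omega>)) = (\<lambda>\<omega>. h (S \<omega>) * X i \<omega>)"
    by (rule ext) (rule mult.commute)
  have intp: "integrable M (\<lambda>\<omega>. h (S \<omega>) * X i \<omega>)"
    using indep_var_integrable[OF indep' intX inth] unfolding commute .
  have cross: "expectation (\<lambda>\<omega>. h (S \<omega>) * X i \<omega>) = 0"
    using indep_var_lebesgue_integral[OF indep' intX inth] insert.prems(4)[OF insertI1]
    unfolding commute by simp
  define U where "U = (\<lambda>\<omega>. \<bar>S \<omega>\<bar> powr \<delta> + \<delta> * (h (S \<omega>) * X i \<omega>) + 4 * \<bar>X i \<omega>\<bar> powr \<delta>)"
  have intU: "integrable M U"
    unfolding U_def using IH(1) intp insert.prems(2)[OF insertI1] by auto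
  have bound: "\<bar>\<Sum>j\<in>insert i I. X j \<omega>\<bar> powr \<delta> \<le> U \<omega>" for \<omega>
    using abs_powr_add_le[OF \<delta>, of "S \<omega>" "X i \<omega>"] insert.hyps
    by (simp add: U_def S_def h_def add.commute)
  have meas: "(\<lambda>\<omega>. \<bar>\<Sum>j\<in>insert i I. X j \<omega>\<bar> powr \<delta>) \<in> borel_measurable M"
  proof -
    have "(\<lambda>\<omega>. \<bar>\<Sum>j\<in>insert i I. X j \<omega>\<bar> powr \<delta>) = (\<lambda>\<omega>. \<bar>X i \<omega> + S \<omega>\<bar> powr \<delta>)"
      using insert.hyps by (simp add: S_def)
    then show ?thesis by simp
  qed
  have int: "integrable M (\<lambda>\<omega>. \<bar>\<Sum>j\<in>insert i I. X j \<omega>\<bar> powr \<delta>)"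
    by (rule Bochner_Integration.integrable_bound[OF intU meas])
      (use bound in \<open>auto intro!: AE_I2 order_trans[OF _ abs_ge_self]\<close>)
  have "expectation (\<lambda>\<omega>. \<bar>\<Sum>j\<in>insert i I. X j \<omega>\<bar> powr \<delta>) \<le> expectation U"
    by (rule integral_mono[OF int intU bound])
  also have "\<dots> = expectation (\<lambda>\<omega>. \<bar>S \<omega>\<bar> powr \<delta>) + 4 * expectation (\<lambda>\<omega>. \<bar>X i \<omega>\<bar> powr \<delta>)"
    unfolding U_def using IH(1) intp insert.prems(2)[OF insertI1] cross by simp
  also have "\<dots> \<le> 4 * real (card I) * v + 4 * v"
    using IH(2) insert.prems(3)[OF insertI1] by simp
  also have "\<dots> = 4 * real (card (insert i I)) * v"
    using insert.hyps by (simp add: algebra_simps)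
  finally show ?case
    using int by blast
qed

text \<open>
  Markov's inequality for the \<open>\<delta>\<close>-th power. The constant \<open>32\<close> makes the quotient of the moment bound
  and the threshold equal to \<open>4 / 32\<close>.
\<close>

lemma prob_indep_mean_deviation_le:
  fixes X :: "'i \<Rightarrow> 'a \<Rightarrow> real" and \<delta> \<nu> :: real
  assumes \<delta>: "1 < \<delta>" "\<delta> \<le> 2" and \<nu>: "\<nu> > 0" and I: "finite I" "card I = s" "s > 0"
    and indep: "indep_vars (\<lambda>_. borel) X I"
    and int: "\<And>i. i \<in> I \<Longrightarrow> integrable M (\<lambda>\<omega>. \<bar>X i \<omega>\<bar> powr \<delta>)"
    and moment: "\<And>i. i \<in> I \<Longrightarrow> expectation (\<lambda>\<omega>. \<bar>X i \<omega>\<bar> powr \<delta>) \<le> \<nu> powr \<delta>"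
    and centered: "\<And>i. i \<in> I \<Longrightarrow> expectation (X i) = 0"
  shows "prob {\<omega> \<in> space M. 32 powr (1 / \<delta>) * \<nu> * real s powr - ((\<delta> - 1) / \<delta>)
     < \<bar>1 / real s * (\<Sum>i\<in>I. X i \<omega>)\<bar>} \<le> 1 / 8"
proof -
  define \<eta> where "\<eta> = 32 powr (1 / \<delta>) * \<nu> * real s powr - ((\<delta> - 1) / \<delta>)"
  define T where "T = (\<lambda>\<omega>. \<Sum>i\<in>I. X i \<omega>)"
  have \<eta>: "\<eta> > 0"
    using \<nu> I by (simp add: \<eta>_def)
  have "(real s * \<eta>) powr \<delta> = real s powr \<delta> * (32 * \<nu> powr \<delta> * real s powr (1 - \<delta>))"
    using \<delta> \<nu> I by (simp add: \<eta>_def powr_mult powr_powr)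
  also have "\<dots> = 32 * \<nu> powr \<delta> * (real s powr \<delta> * real s powr (1 - \<delta>))"
    by simp
  also have "real s powr \<delta> * real s powr (1 - \<delta>) = real s"
    using I by (simp flip: powr_add)
  finally have threshold: "(real s * \<eta>) powr \<delta> = 32 * \<nu> powr \<delta> * real s" .
  have [measurable]: "X i \<in> borel_measurable M" if "i \<in> I" for i
    using indep that by (auto simp: indep_vars_def)
  have [measurable]: "T \<in> borel_measurable M"
    unfolding T_def by measurable
  have m: "integrable M (\<lambda>\<omega>. \<bar>T \<omega>\<bar> powr \<delta>)" "expectation (\<lambda>\<omega>. \<bar>T \<omega>\<bar> powr \<delta>) \<le> 4 * real s * \<nu> powr \<delta>"
    using moment_indep_sum_le[OF \<delta> I(1) indep int moment centered] I(2) by (auto simp: T_def)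
  have "prob {\<omega> \<in> space M. \<eta> < \<bar>1 / real s * T \<omega>\<bar>} \<le> prob {\<omega> \<in> space M. (real s * \<eta>) powr \<delta> \<le> \<bar>T \<omega>\<bar> powr \<delta>}"
  proof (intro finite_measure_mono subsetI CollectI conjI)
    fix \<omega> assume "\<omega> \<in> {\<omega> \<in> space M. \<eta> < \<bar>1 / real s * T \<omega>\<bar>}"
    then have "\<omega> \<in> space M" "real s * \<eta> \<le> \<bar>T \<omega>\<bar>"
      using I by (auto simp: abs_mult field_simps)
    then show "\<omega> \<in> space M" "(real s * \<eta>) powr \<delta> \<le> \<bar>T \<omega>\<bar> powr \<delta>"
      using \<eta> \<delta> by (auto intro!: powr_mono2)
  qed measurable
  also have "\<dots> \<le> expectation (\<lambda>\<omega>. \<bar>T \<omega>\<bar> powr \<delta>) / (real s * \<eta>) powr \<delta>"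
    by (rule integral_Markov_inequality_measure[where A = "{}"]) (use m \<eta> I in auto)
  also have "\<dots> \<le> 4 * real s * \<nu> powr \<delta> / (32 * \<nu> powr \<delta> * real s)"
    unfolding threshold using m(2) \<nu> I by (intro divide_right_mono) auto
  also have "\<dots> = 1 / 8"
    using \<nu> I by simp
  finally show ?thesis
    unfolding \<eta>_def T_def .
qed

text \<open>
  Block means over disjoint blocks are independent, so a given set of at least \<open>n / 2\<close> blocks errs as
  a whole with probability at most \<open>(1/8) powr (n/2)\<close>, and there are at most \<open>2 ^ n\<close> such sets. Since
  the single-block probability is below \<open>1/4\<close>, this crude union bound already decays exponentially
  in \<open>n\<close>.
\<close>

lemma median_of_means_failure:
  fixes X :: "'i \<Rightarrow> 'a \<Rightarrow> real" and \<delta> \<nu> :: real and B :: "nat \<Rightarrow> 'i set"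
  defines "\<eta> \<equiv> \<lambda>s::nat. 32 powr (1 / \<delta>) * \<nu> * real s powr - ((\<delta> - 1) / \<delta>)"
  assumes \<delta>: "1 < \<delta>" "\<delta> \<le> 2" and \<nu>: "\<nu> > 0" and I: "finite I" and s: "s > 0" and n: "n > 0"
    and B: "disjoint_family_on B {1..n}" "\<And>l. l \<in> {1..n} \<Longrightarrow> B l \<subseteq> I \<and> card (B l) = s"
    and indep: "indep_vars (\<lambda>_. borel) X I"
    and int: "\<And>i. i \<in> I \<Longrightarrow> integrable M (\<lambda>\<omega>. \<bar>X i \<omega>\<bar> powr \<delta>)"
    and moment: "\<And>i. i \<in> I \<Longrightarrow> expectation (\<lambda>\<omega>. \<bar>X i \<omega>\<bar> powr \<delta>) \<le> \<nu> powr \<delta>"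
    and centered: "\<And>i. i \<in> I \<Longrightarrow> expectation (X i) = 0"
  shows "prob {\<omega> \<in> space M. n \<le> 2 * card {l \<in> {1..n}. \<eta> s < \<bar>1 / real s * (\<Sum>i\<in>B l. X i \<omega>)\<bar>}}
    \<le> (1 / 2) powr (real n / 2)"
proof -
  define Y where "Y = (\<lambda>l \<omega>. 1 / real s * (\<Sum>i\<in>B l. X i \<omega>))"
  define bad where "bad = (\<lambda>l. {\<omega> \<in> space M. \<eta> s < \<bar>Y l \<omega>\<bar>})"
  have "indep_vars (\<lambda>_. borel) (\<lambda>l \<omega>. 1 / real s * (\<Sum>i\<in>B l. (restrict (\<lambda>i. X i \<omega>) (B l)) i)) {1..n}"
    by (rule indep_vars_compose2[OF indep_vars_restrict[OF indep _ B(1)]]) (use B(2) in auto)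
  then have indepY: "indep_vars (\<lambda>_. borel) Y {1..n}"
    by (simp add: Y_def)
  then have Y_meas[measurable]: "Y l \<in> borel_measurable M" if "l \<in> {1..n}" for l
    using that by (auto simp: indep_vars_def)
  have bad_sets[measurable]: "bad l \<in> sets M" if "l \<in> {1..n}" for l
    using Y_meas[OF that] unfolding bad_def by measurable
  have bad_prob: "prob (bad l) \<le> 1 / 8" if l: "l \<in> {1..n}" for l
    unfolding bad_def Y_def \<eta>_def
    using B(2)[OF l] I s
    by (intro prob_indep_mean_deviation_le[OF \<delta> \<nu> _ _ _ indep_vars_subset[OF indep]])
      (auto intro: finite_subset int moment centered)
  \<comment> \<open>the sets of blocks that are large enough to mislead the median\<close>
  define \<T> where "\<T> = {T. T \<subseteq> {1..n} \<and> n \<le> 2 * card T}"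
  have "finite \<T>"
    unfolding \<T>_def by (rule finite_subset[of _ "Pow {1..n}"]) auto
  have T_prob: "prob (\<Inter>l\<in>T. bad l) \<le> (1 / 8) powr (real n / 2)" if T: "T \<in> \<T>" for T
  proof -
    have "T \<subseteq> {1..n}" "n \<le> 2 * card T" "finite T" "T \<noteq> {}"
      using T n by (auto simp: \<T>_def intro: finite_subset)
    have "prob (\<Inter>l\<in>T. bad l) = prob (\<Inter>l\<in>T. Y l -` {u. \<eta> s < \<bar>u\<bar>} \<inter> space M)"
      by (rule arg_cong[where f = prob]) (auto simp: bad_def)
    also have "\<dots> = (\<Prod>l\<in>T. prob (Y l -` {u. \<eta> s < \<bar>u\<bar>} \<inter> space M))"
      using indepY \<open>T \<subseteq> _\<close> \<open>T \<noteq> {}\<close> \<open>finite T\<close> by (intro indep_varsD) auto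
    also have "\<dots> \<le> (\<Prod>l\<in>T. 1 / 8)"
    proof (intro prod_mono conjI)
      fix l assume "l \<in> T"
      have "Y l -` {u. \<eta> s < \<bar>u\<bar>} \<inter> space M = bad l"
        by (auto simp: bad_def)
      then show "prob (Y l -` {u. \<eta> s < \<bar>u\<bar>} \<inter> space M) \<le> 1 / 8"
        using bad_prob[of l] \<open>l \<in> T\<close> \<open>T \<subseteq> _\<close> by auto
    qed simp
    also have "\<dots> = (1 / 8) powr real (card T)"
      by (simp add: powr_realpow)
    also have "\<dots> \<le> (1 / 8) powr (real n / 2)"
      using \<open>n \<le> 2 * card T\<close> by (intro powr_mono') auto
    finally show ?thesis .
  qed
  have "prob {\<omega> \<in> space M. n \<le> 2 * card {l \<in> {1..n}. \<eta> s < \<bar>Y l \<omega>\<bar>}} \<le> prob (\<Union>T\<in>\<T>. \<Inter>l\<in>T. bad l)"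
  proof (rule finite_measure_mono)
    have T_ne: "T \<noteq> {}" "T \<subseteq> {1..n}" "finite T" if "T \<in> \<T>" for T
      using that n by (auto simp: \<T>_def intro: finite_subset)
    show "(\<Union>T\<in>\<T>. \<Inter>l\<in>T. bad l) \<in> events"
    proof (intro sets.finite_UN \<open>finite \<T>\<close>)
      fix T assume "T \<in> \<T>"
      then show "(\<Inter>l\<in>T. bad l) \<in> events"
        using T_ne[of T] by (intro sets.finite_INT bad_sets) auto
    qed
    show "{\<omega> \<in> space M. n \<le> 2 * card {l \<in> {1..n}. \<eta> s < \<bar>Y l \<omega>\<bar>}} \<subseteq> (\<Union>T\<in>\<T>. \<Inter>l\<in>T. bad l)"
    proof
      fix \<omega> assume \<omega>: "\<omega> \<in> {\<omega> \<in> space M. n \<le> 2 * card {l \<in> {1..n}. \<eta> s < \<bar>Y l \<omega>\<bar>}}"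
      then have "{l \<in> {1..n}. \<eta> s < \<bar>Y l \<omega>\<bar>} \<in> \<T>"
        by (auto simp: \<T>_def)
      moreover have "\<omega> \<in> (\<Inter>l\<in>{l \<in> {1..n}. \<eta> s < \<bar>Y l \<omega>\<bar>}. bad l)"
        using \<omega> by (auto simp: bad_def)
      ultimately show "\<omega> \<in> (\<Union>T\<in>\<T>. \<Inter>l\<in>T. bad l)"
        by blast
    qed
  qed
  also have "\<dots> \<le> (\<Sum>T\<in>\<T>. prob (\<Inter>l\<in>T. bad l))"
  proof (rule finite_measure_subadditive_finite[OF \<open>finite \<T>\<close>], safe)
    fix T assume "T \<in> \<T>"
    then have "T \<noteq> {}" "T \<subseteq> {1..n}" "finite T"
      using n by (auto simp: \<T>_def intro: finite_subset)
    then show "(\<Inter>l\<in>T. bad l) \<in> events"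
      by (intro sets.finite_INT bad_sets) auto
  qed
  also have "\<dots> \<le> (\<Sum>T\<in>\<T>. (1 / 8) powr (real n / 2))"
    by (intro sum_mono T_prob)
  also have "\<dots> \<le> 2 ^ n * (1 / 8) powr (real n / 2)"
  proof -
    have "card \<T> \<le> card (Pow {1..n})"
      by (rule card_mono) (auto simp: \<T>_def)
    also have "\<dots> = 2 ^ n"
      by (simp add: card_Pow)
    finally have "real (card \<T>) \<le> real (2 ^ n)"
      by (rule of_nat_mono)
    then show ?thesis
      by (simp add: mult_right_mono)
  qed
  also have "\<dots> = 4 powr (real n / 2) * (1 / 8) powr (real n / 2)"
  proof -
    have "(4::real) powr (real n / 2) = (2 powr 2) powr (real n / 2)"
      by simp
    also have "\<dots> = 2 powr real n"
      by (simp only: powr_powr) simp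
    also have "\<dots> = 2 ^ n"
      by (simp add: powr_realpow)
    finally show ?thesis by simp
  qed
  also have "\<dots> = (1 / 2) powr (real n / 2)"
    by (subst powr_mult[symmetric]) simp_all
  finally show ?thesis
    unfolding Y_def .
qed

end

section \<open>Conditioning on the past by freezing it\<close>

lemma measurable_majority:
  fixes Y :: "nat \<Rightarrow> 'w \<Rightarrow> real"
  assumes [measurable]: "\<And>l. l \<in> {1..n} \<Longrightarrow> Y l \<in> borel_measurable N"
  shows "Measurable.pred N (\<lambda>\<omega>. n \<le> 2 * card {l \<in> {1..n}. \<eta> < \<bar>Y l \<omega>\<bar>})"
proof -
  have "n \<le> 2 * card {l \<in> {1..n}. \<eta> < \<bar>Y l \<omega>\<bar>} \<longleftrightarrow>
      real n \<le> 2 * (\<Sum>l\<in>{1..n}. if \<eta> < \<bar>Y l \<omega>\<bar> then 1 else 0)" for \<omega>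
  proof -
    have "(\<Sum>l\<in>{1..n}. if \<eta> < \<bar>Y l \<omega>\<bar> then 1 else 0 :: real) = real (card {l \<in> {1..n}. \<eta> < \<bar>Y l \<omega>\<bar>})"
      by (simp add: sum.If_cases Int_def)
    then show ?thesis
      by (metis (no_types, lifting) of_nat_le_iff of_nat_mult of_nat_numeral)
  qed
  then show ?thesis
    by simp
qed

context prob_space begin

lemma indep_set_vimage:
  assumes G: "subalgebra M G" and Y: "Y \<in> measurable G N" and indep: "indep_set (sets F) (sets G)"
  shows "indep_set (sets F) {Y -` B \<inter> space M |B. B \<in> sets N}"
proof -
  have "{Y -` B \<inter> space M |B. B \<in> sets N} \<subseteq> sets G"
    using G measurable_sets[OF Y] by (auto simp: subalgebra_def)
  then show ?thesis
    using indep unfolding indep_sets2_eq by blast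
qed

text \<open>
  The first component of the pair is the sample point itself, seen through the \<open>\<sigma>\<close>-algebra \<open>F\<close>.
  Keeping the entire past as one coordinate allows every \<open>F\<close>-measurable quantity to be frozen at once.
\<close>

lemma distr_pair_subalgebra:
  assumes F: "subalgebra M F" and Y: "random_variable N Y"
    and indep: "indep_set (sets F) {Y -` B \<inter> space M |B. B \<in> sets N}"
  shows "distr M F (\<lambda>\<omega>. \<omega>) \<Otimes>\<^sub>M distr M N Y = distr M (F \<Otimes>\<^sub>M N) (\<lambda>\<omega>. (\<omega>, Y \<omega>))"
proof (rule pair_measure_eqI)
  note [measurable] = Y
  have id[measurable]: "(\<lambda>\<omega>. \<omega>) \<in> measurable M F"
    using measurable_from_subalg[OF F measurable_ident] by (simp add: id_def)
  interpret X: prob_space "distr M F (\<lambda>\<omega>. \<omega>)"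
    by (rule prob_space_distr) fact
  interpret Y: prob_space "distr M N Y"
    by (rule prob_space_distr) fact
  show "sigma_finite_measure (distr M F (\<lambda>\<omega>. \<omega>))" "sigma_finite_measure (distr M N Y)"
    by unfold_locales
  show "sets (distr M F (\<lambda>\<omega>. \<omega>) \<Otimes>\<^sub>M distr M N Y) = sets (distr M (F \<Otimes>\<^sub>M N) (\<lambda>\<omega>. (\<omega>, Y \<omega>)))"
    by (simp cong: sets_pair_measure_cong)
  fix A B assume "A \<in> sets (distr M F (\<lambda>\<omega>. \<omega>))" "B \<in> sets (distr M N Y)"
  then have A[measurable]: "A \<in> sets F" and B[measurable]: "B \<in> sets N"
    by auto
  have "A \<subseteq> space M"
    using sets.sets_into_space[OF A] F by (simp add: subalgebra_def)
  then have "emeasure (distr M (F \<Otimes>\<^sub>M N) (\<lambda>\<omega>. (\<omega>, Y \<omega>))) (A \<times> B) = prob (A \<inter> (Y -` B \<inter> space M))"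
    by (subst emeasure_distr) (auto simp: emeasure_eq_measure intro!: arg_cong[where f = prob])
  also have "\<dots> = prob A * prob (Y -` B \<inter> space M)"
    by (intro arg_cong[where f = ennreal] indep_setD[OF indep A]) (use B in blast)
  also have "\<dots> = emeasure (distr M F (\<lambda>\<omega>. \<omega>)) A * emeasure (distr M N Y) B"
    using \<open>A \<subseteq> space M\<close> by (simp add: emeasure_distr emeasure_eq_measure ennreal_mult Int_absorb2)
  finally show "emeasure (distr M F (\<lambda>\<omega>. \<omega>)) A * emeasure (distr M N Y) B =
      emeasure (distr M (F \<Otimes>\<^sub>M N) (\<lambda>\<omega>. (\<omega>, Y \<omega>))) (A \<times> B)"
    by simp
qed

text \<open>
  Fubini's theorem for the product law of \<open>distr_pair_subalgebra\<close>: the variable \<open>Y\<close> may be resampled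
  while the past stays fixed.
\<close>

lemma nn_integral_freeze:
  assumes F: "subalgebra M F" and Y[measurable]: "random_variable N Y"
    and indep: "indep_set (sets F) {Y -` B \<inter> space M |B. B \<in> sets N}"
    and \<Phi>[measurable]: "\<Phi> \<in> borel_measurable (F \<Otimes>\<^sub>M N)"
  shows "(\<integral>\<^sup>+\<omega>. \<Phi> (\<omega>, Y \<omega>) \<partial>M) = (\<integral>\<^sup>+\<omega>. (\<integral>\<^sup>+\<omega>'. \<Phi> (\<omega>, Y \<omega>') \<partial>M) \<partial>M)"
    and "(\<lambda>\<omega>. \<integral>\<^sup>+\<omega>'. \<Phi> (\<omega>, Y \<omega>') \<partial>M) \<in> borel_measurable F"
proof -
  have id[measurable]: "(\<lambda>\<omega>. \<omega>) \<in> measurable M F"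
    using measurable_from_subalg[OF F measurable_ident] by (simp add: id_def)
  interpret Y: prob_space "distr M N Y"
    by (rule prob_space_distr) fact
  have \<Phi>'[measurable]: "\<Phi> \<in> borel_measurable (F \<Otimes>\<^sub>M distr M N Y)"
    by (simp cong: measurable_cong_sets sets_pair_measure_cong)
  have inner: "(\<integral>\<^sup>+z. \<Phi> (\<omega>, z) \<partial>distr M N Y) = (\<integral>\<^sup>+\<omega>'. \<Phi> (\<omega>, Y \<omega>') \<partial>M)" if "\<omega> \<in> space F" for \<omega>
    using that by (intro nn_integral_distr) (auto intro: measurable_compose[OF measurable_Pair1' \<Phi>])
  have m: "(\<lambda>\<omega>. \<integral>\<^sup>+z. \<Phi> (\<omega>, z) \<partial>distr M N Y) \<in> borel_measurable F"
    by (rule Y.borel_measurable_nn_integral_fst[OF \<Phi>'])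
  then show "(\<lambda>\<omega>. \<integral>\<^sup>+\<omega>'. \<Phi> (\<omega>, Y \<omega>') \<partial>M) \<in> borel_measurable F"
    using inner by (simp cong: measurable_cong)
  have "(\<integral>\<^sup>+\<omega>. \<Phi> (\<omega>, Y \<omega>) \<partial>M) = integral\<^sup>N (distr M (F \<Otimes>\<^sub>M N) (\<lambda>\<omega>. (\<omega>, Y \<omega>))) \<Phi>"
    by (subst nn_integral_distr) auto
  also have "\<dots> = integral\<^sup>N (distr M F (\<lambda>\<omega>. \<omega>) \<Otimes>\<^sub>M distr M N Y) \<Phi>"
    by (simp add: distr_pair_subalgebra[OF F Y indep])
  also have "\<dots> = (\<integral>\<^sup>+\<omega>. \<integral>\<^sup>+z. \<Phi> (\<omega>, z) \<partial>distr M N Y \<partial>distr M F (\<lambda>\<omega>. \<omega>))"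
    by (rule Y.nn_integral_fst[symmetric]) (simp cong: measurable_cong_sets sets_pair_measure_cong)
  also have "\<dots> = (\<integral>\<^sup>+\<omega>. \<integral>\<^sup>+z. \<Phi> (\<omega>, z) \<partial>distr M N Y \<partial>M)"
    by (rule nn_integral_distr[OF id]) (use m in simp)
  also have "\<dots> = (\<integral>\<^sup>+\<omega>. (\<integral>\<^sup>+\<omega>'. \<Phi> (\<omega>, Y \<omega>') \<partial>M) \<partial>M)"
    using F by (intro nn_integral_cong inner) (simp add: subalgebra_def)
  finally show "(\<integral>\<^sup>+\<omega>. \<Phi> (\<omega>, Y \<omega>) \<partial>M) = (\<integral>\<^sup>+\<omega>. (\<integral>\<^sup>+\<omega>'. \<Phi> (\<omega>, Y \<omega>') \<partial>M) \<partial>M)" .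
qed

text \<open>
  Multiplying \<open>\<Phi>\<close> by the indicator of an event of \<open>F\<close> and integrating verifies the defining
  property of conditional expectation.
\<close>

lemma nn_cond_exp_freeze:
  assumes F: "subalgebra M F" and Y[measurable]: "random_variable N Y"
    and indep: "indep_set (sets F) {Y -` B \<inter> space M |B. B \<in> sets N}"
    and \<Phi>[measurable]: "\<Phi> \<in> borel_measurable (F \<Otimes>\<^sub>M N)"
  shows "AE \<omega> in M. nn_cond_exp M F (\<lambda>\<omega>. \<Phi> (\<omega>, Y \<omega>)) \<omega> = (\<integral>\<^sup>+\<omega>'. \<Phi> (\<omega>, Y \<omega>') \<partial>M)"
proof -
  have id[measurable]: "(\<lambda>\<omega>. \<omega>) \<in> measurable M F"
    using measurable_from_subalg[OF F measurable_ident] by (simp add: id_def)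
  interpret F: finite_measure_subalgebra M F
    by unfold_locales (rule F)
  have "AE \<omega> in M. (\<integral>\<^sup>+\<omega>'. \<Phi> (\<omega>, Y \<omega>') \<partial>M) = nn_cond_exp M F (\<lambda>\<omega>. \<Phi> (\<omega>, Y \<omega>)) \<omega>"
  proof (rule F.nn_cond_exp_charact)
    show "(\<lambda>\<omega>. \<integral>\<^sup>+\<omega>'. \<Phi> (\<omega>, Y \<omega>') \<partial>M) \<in> borel_measurable F"
      by (rule nn_integral_freeze(2)[OF F Y indep \<Phi>])
    show "(\<lambda>\<omega>. \<Phi> (\<omega>, Y \<omega>)) \<in> borel_measurable M"
      by measurable
    fix A assume A[measurable]: "A \<in> sets F"
    have "(\<integral>\<^sup>+\<omega>\<in>A. \<Phi> (\<omega>, Y \<omega>) \<partial>M) = (\<integral>\<^sup>+\<omega>. (\<integral>\<^sup>+\<omega>'. \<Phi> (\<omega>, Y \<omega>') * indicator A \<omega> \<partial>M) \<partial>M)"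
      using nn_integral_freeze(1)[OF F Y indep, of "\<lambda>p. \<Phi> p * indicator A (fst p)"] by simp
    also have "\<dots> = (\<integral>\<^sup>+\<omega>\<in>A. (\<integral>\<^sup>+\<omega>'. \<Phi> (\<omega>, Y \<omega>') \<partial>M) \<partial>M)"
      by (intro nn_integral_cong) (auto simp: indicator_def)
    finally show "(\<integral>\<^sup>+\<omega>\<in>A. \<Phi> (\<omega>, Y \<omega>) \<partial>M) = (\<integral>\<^sup>+\<omega>\<in>A. (\<integral>\<^sup>+\<omega>'. \<Phi> (\<omega>, Y \<omega>') \<partial>M) \<partial>M)" .
  qed
  then show ?thesis
    by (rule AE_mp) auto
qed

text \<open>
  A bound that holds for almost every frozen past holds on average over the pasts.
\<close>

lemma prob_freeze_le:
  assumes F: "subalgebra M F" and Y[measurable]: "random_variable N Y"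
    and indep: "indep_set (sets F) {Y -` B \<inter> space M |B. B \<in> sets N}"
    and E[measurable]: "Measurable.pred (F \<Otimes>\<^sub>M N) E" and p: "p \<ge> 0"
    and le: "AE \<omega> in M. prob {\<omega>' \<in> space M. E (\<omega>, Y \<omega>')} \<le> p"
  shows "prob {\<omega> \<in> space M. E (\<omega>, Y \<omega>)} \<le> p"
proof -
  have id[measurable]: "(\<lambda>\<omega>. \<omega>) \<in> measurable M F"
    using measurable_from_subalg[OF F measurable_ident] by (simp add: id_def)
  define \<Phi> :: "_ \<Rightarrow> ennreal" where "\<Phi> = (\<lambda>p. if E p then 1 else 0)"
  have \<Phi>[measurable]: "\<Phi> \<in> borel_measurable (F \<Otimes>\<^sub>M N)"
    unfolding \<Phi>_def by measurable
  have ind: "(\<integral>\<^sup>+\<omega>. (if Q \<omega> then 1 else 0) \<partial>M) = emeasure M {\<omega> \<in> space M. Q \<omega>}"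
    if [measurable]: "Measurable.pred M Q" for Q
  proof -
    have "(\<integral>\<^sup>+\<omega>. (if Q \<omega> then 1 else 0) \<partial>M) = (\<integral>\<^sup>+\<omega>. indicator {\<omega> \<in> space M. Q \<omega>} \<omega> \<partial>M)"
      by (intro nn_integral_cong) auto
    then show ?thesis by simp
  qed
  have "emeasure M {\<omega> \<in> space M. E (\<omega>, Y \<omega>)} = (\<integral>\<^sup>+\<omega>. \<Phi> (\<omega>, Y \<omega>) \<partial>M)"
    unfolding \<Phi>_def by (rule ind[symmetric]) measurable
  also have "\<dots> = (\<integral>\<^sup>+\<omega>. (\<integral>\<^sup>+\<omega>'. \<Phi> (\<omega>, Y \<omega>') \<partial>M) \<partial>M)"
    by (rule nn_integral_freeze(1)[OF F Y indep \<Phi>])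
  also have "\<dots> \<le> (\<integral>\<^sup>+\<omega>. ennreal p \<partial>M)"
  proof (rule nn_integral_mono_AE)
    show "AE \<omega> in M. (\<integral>\<^sup>+\<omega>'. \<Phi> (\<omega>, Y \<omega>') \<partial>M) \<le> ennreal p"
      using le AE_space
    proof eventually_elim
      case (elim \<omega>)
      then have [measurable]: "Measurable.pred M (\<lambda>\<omega>'. E (\<omega>, Y \<omega>'))"
        using F by (intro measurable_compose[OF _ E] measurable_Pair) (auto simp: subalgebra_def)
      have "(\<integral>\<^sup>+\<omega>'. \<Phi> (\<omega>, Y \<omega>') \<partial>M) = emeasure M {\<omega>' \<in> space M. E (\<omega>, Y \<omega>')}"
        unfolding \<Phi>_def by (rule ind) measurable
      also have "\<dots> \<le> ennreal p"
        using elim by (simp add: emeasure_eq_measure ennreal_leI)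
      finally show ?case .
    qed
  qed
  also have "\<dots> = ennreal p"
    by (simp add: emeasure_space_1)
  finally show ?thesis
    using p by (simp add: emeasure_eq_measure)
qed

text \<open>
  Translates conditions on conditional expectations into conditions on ordinary expectations, one past
  at a time. The conditional mean is by definition the difference of the conditional expectations of
  positive and negative part; the moment bound makes both finite, so that their difference is the
  integral.
\<close>

lemma frozen_noise_moments:
  fixes \<Phi> :: "'a \<times> 'b \<Rightarrow> real" and \<delta> \<nu> :: real
  assumes F: "subalgebra M F" and Y[measurable]: "random_variable N Y"
    and indep: "indep_set (sets F) {Y -` B \<inter> space M |B. B \<in> sets N}"
    and \<Phi>[measurable]: "\<Phi> \<in> borel_measurable (F \<Otimes>\<^sub>M N)" and \<delta>: "1 \<le> \<delta>"
    and mean: "AE \<omega> in M. real_cond_exp M F (\<lambda>\<omega>. \<Phi> (\<omega>, Y \<omega>)) \<omega> = 0"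
    and moment: "AE \<omega> in M. nn_cond_exp M F (\<lambda>\<omega>. ennreal (\<bar>\<Phi> (\<omega>, Y \<omega>)\<bar> powr \<delta>)) \<omega> \<le> ennreal (\<nu> powr \<delta>)"
  shows "AE \<omega> in M. integrable M (\<lambda>\<omega>'. \<bar>\<Phi> (\<omega>, Y \<omega>')\<bar> powr \<delta>) \<and>
    expectation (\<lambda>\<omega>'. \<bar>\<Phi> (\<omega>, Y \<omega>')\<bar> powr \<delta>) \<le> \<nu> powr \<delta> \<and>
    expectation (\<lambda>\<omega>'. \<Phi> (\<omega>, Y \<omega>')) = 0"
proof -
  have pos: "AE \<omega> in M. nn_cond_exp M F (\<lambda>\<omega>. ennreal (\<Phi> (\<omega>, Y \<omega>))) \<omega> = (\<integral>\<^sup>+\<omega>'. ennreal (\<Phi> (\<omega>, Y \<omega>')) \<partial>M)"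
    by (rule nn_cond_exp_freeze[OF F Y indep, of "\<lambda>p. ennreal (\<Phi> p)"]) measurable
  have neg: "AE \<omega> in M. nn_cond_exp M F (\<lambda>\<omega>. ennreal (- \<Phi> (\<omega>, Y \<omega>))) \<omega> = (\<integral>\<^sup>+\<omega>'. ennreal (- \<Phi> (\<omega>, Y \<omega>')) \<partial>M)"
    by (rule nn_cond_exp_freeze[OF F Y indep, of "\<lambda>p. ennreal (- \<Phi> p)"]) measurable
  have pow: "AE \<omega> in M. nn_cond_exp M F (\<lambda>\<omega>. ennreal (\<bar>\<Phi> (\<omega>, Y \<omega>)\<bar> powr \<delta>)) \<omega> =
      (\<integral>\<^sup>+\<omega>'. ennreal (\<bar>\<Phi> (\<omega>, Y \<omega>')\<bar> powr \<delta>) \<partial>M)"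
    by (rule nn_cond_exp_freeze[OF F Y indep, of "\<lambda>p. ennreal (\<bar>\<Phi> p\<bar> powr \<delta>)"]) measurable
  show ?thesis
    using pos neg pow mean moment AE_space
  proof eventually_elim
    case (elim \<omega>)
    then have m[measurable]: "(\<lambda>\<omega>'. \<Phi> (\<omega>, Y \<omega>')) \<in> borel_measurable M"
      using F by (intro measurable_compose[OF _ \<Phi>] measurable_Pair) (auto simp: subalgebra_def)
    have le: "(\<integral>\<^sup>+\<omega>'. ennreal (\<bar>\<Phi> (\<omega>, Y \<omega>')\<bar> powr \<delta>) \<partial>M) \<le> ennreal (\<nu> powr \<delta>)"
      using elim(3,5) by simp
    have int: "integrable M (\<lambda>\<omega>'. \<bar>\<Phi> (\<omega>, Y \<omega>')\<bar> powr \<delta>)"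
      using le by (intro integrableI_bounded) (auto intro: le_less_trans)
    have "expectation (\<lambda>\<omega>'. \<bar>\<Phi> (\<omega>, Y \<omega>')\<bar> powr \<delta>) \<le> \<nu> powr \<delta>"
      using le by (subst (asm) nn_integral_eq_integral[OF int]) auto
    moreover have "expectation (\<lambda>\<omega>'. \<Phi> (\<omega>, Y \<omega>')) = 0"
      using elim(1,2,4) real_lebesgue_integral_def[OF integrable_if_higher_moment[OF m int \<delta>]]
      by (simp add: real_cond_exp_def)
    ultimately show ?case
      using int by blast
  qed
qed

text \<open>
  For almost every frozen past the variables \<open>\<Phi> (\<omega>, X i \<omega>')\<close> satisfy the hypotheses of
  \<open>median_of_means_failure\<close>: they are functions of the independent \<open>X i\<close>, and
  \<open>frozen_noise_moments\<close> supplies their moments.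
\<close>

lemma conditional_median_of_means_failure:
  fixes X :: "'i \<Rightarrow> 'a \<Rightarrow> real" and \<Phi> :: "'a \<times> real \<Rightarrow> real" and \<delta> \<nu> :: real and B :: "nat \<Rightarrow> 'i set"
  defines "\<eta> \<equiv> \<lambda>s::nat. 32 powr (1 / \<delta>) * \<nu> * real s powr - ((\<delta> - 1) / \<delta>)"
  assumes \<delta>: "1 < \<delta>" "\<delta> \<le> 2" and \<nu>: "\<nu> > 0" and I: "finite I" and s: "s > 0" and n: "n > 0"
    and B: "disjoint_family_on B {1..n}" "\<And>l. l \<in> {1..n} \<Longrightarrow> B l \<subseteq> I \<and> card (B l) = s"
    and F: "subalgebra M F" and G: "subalgebra M G" and FG: "indep_set (sets F) (sets G)"
    and XG: "\<And>i. i \<in> I \<Longrightarrow> X i \<in> borel_measurable G"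
    and indep: "indep_vars (\<lambda>_. borel) X I"
    and \<Phi>[measurable]: "\<Phi> \<in> borel_measurable (F \<Otimes>\<^sub>M borel)"
    and mean: "\<And>i. i \<in> I \<Longrightarrow> AE \<omega> in M. real_cond_exp M F (\<lambda>\<omega>. \<Phi> (\<omega>, X i \<omega>)) \<omega> = 0"
    and moment: "\<And>i. i \<in> I \<Longrightarrow>
      AE \<omega> in M. nn_cond_exp M F (\<lambda>\<omega>. ennreal (\<bar>\<Phi> (\<omega>, X i \<omega>)\<bar> powr \<delta>)) \<omega> \<le> ennreal (\<nu> powr \<delta>)"
  shows "prob {\<omega> \<in> space M. n \<le> 2 * card {l \<in> {1..n}. \<eta> s < \<bar>1 / real s * (\<Sum>i\<in>B l. \<Phi> (\<omega>, X i \<omega>))\<bar>}}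
    \<le> (1 / 2) powr (real n / 2)"
proof -
  define Y where "Y = (\<lambda>\<omega>. \<lambda>i\<in>I. X i \<omega>)"
  define E where "E = (\<lambda>p :: 'a \<times> ('i \<Rightarrow> real).
     n \<le> 2 * card {l \<in> {1..n}. \<eta> s < \<bar>1 / real s * (\<Sum>i\<in>B l. \<Phi> (fst p, snd p i))\<bar>})"
  have Y: "Y \<in> measurable G (PiM I (\<lambda>_. borel))"
    unfolding Y_def by (intro measurable_restrict XG)
  note YM = measurable_from_subalg[OF G Y]
  note indepY = indep_set_vimage[OF G Y FG]
  have [measurable]: "(\<lambda>p. \<Phi> (fst p, snd p i)) \<in> borel_measurable (F \<Otimes>\<^sub>M PiM I (\<lambda>_. borel))" if "i \<in> I" for i
    using that by measurable
  have "(\<lambda>p. \<Sum>i\<in>B l. \<Phi> (fst p, snd p i)) \<in> borel_measurable (F \<Otimes>\<^sub>M PiM I (\<lambda>_. borel))" if "l \<in> {1..n}" for l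
    using B(2)[OF that] by (intro borel_measurable_sum) (auto intro: that)
  then have [measurable]: "Measurable.pred (F \<Otimes>\<^sub>M PiM I (\<lambda>_. borel)) E"
    unfolding E_def by (intro measurable_majority borel_measurable_times) auto
  have frozen: "AE \<omega> in M. \<forall>i\<in>I. integrable M (\<lambda>\<omega>'. \<bar>\<Phi> (\<omega>, X i \<omega>')\<bar> powr \<delta>) \<and>
    expectation (\<lambda>\<omega>'. \<bar>\<Phi> (\<omega>, X i \<omega>')\<bar> powr \<delta>) \<le> \<nu> powr \<delta> \<and>
    expectation (\<lambda>\<omega>'. \<Phi> (\<omega>, X i \<omega>')) = 0"
    using I \<delta>
    by (intro AE_finite_allI frozen_noise_moments[OF F measurable_from_subalg[OF G XG] indep_set_vimage[OF G XG FG] \<Phi>] mean moment) auto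
  have "prob {\<omega> \<in> space M. E (\<omega>, Y \<omega>)} \<le> (1 / 2) powr (real n / 2)"
  proof (rule prob_freeze_le[OF F YM indepY])
    show "AE \<omega> in M. prob {\<omega>' \<in> space M. E (\<omega>, Y \<omega>')} \<le> (1 / 2) powr (real n / 2)"
      using frozen AE_space
    proof eventually_elim
      case (elim \<omega>)
      then have \<omega>: "\<omega> \<in> space F"
        using F by (simp add: subalgebra_def)
      have "indep_vars (\<lambda>_. borel) (\<lambda>i \<omega>'. \<Phi> (\<omega>, X i \<omega>')) I"
        by (rule indep_vars_compose2[OF indep, where Y = "\<lambda>i z. \<Phi> (\<omega>, z)"])
          (use \<omega> in \<open>auto intro: measurable_compose[OF measurable_Pair1' \<Phi>]\<close>)
      from median_of_means_failure[OF \<delta> \<nu> I s n B this]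
      have "prob {\<omega>' \<in> space M. n \<le> 2 * card {l \<in> {1..n}. \<eta> s < \<bar>1 / real s * (\<Sum>i\<in>B l. \<Phi> (\<omega>, X i \<omega>'))\<bar>}}
        \<le> (1 / 2) powr (real n / 2)"
        using elim(1) unfolding \<eta>_def by blast
      moreover have "(\<Sum>i\<in>B l. \<Phi> (\<omega>, Y \<omega>' i)) = (\<Sum>i\<in>B l. \<Phi> (\<omega>, X i \<omega>'))" if "l \<in> {1..n}" for l \<omega>'
        using B(2)[OF that] by (intro sum.cong) (auto simp: Y_def)
      ultimately show ?case
        by (simp add: E_def cong: conj_cong)
    qed
  qed simp_all
  moreover have "(\<Sum>i\<in>B l. \<Phi> (\<omega>, Y \<omega> i)) = (\<Sum>i\<in>B l. \<Phi> (\<omega>, X i \<omega>))" if "l \<in> {1..n}" for l \<omega>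
    using B(2)[OF that] by (intro sum.cong) (auto simp: Y_def)
  ultimately show ?thesis
    by (simp add: E_def cong: conj_cong)
qed

end

section \<open>Nash equilibria and variational inequalities\<close>

lemma replace_coord_component: "replace_coord x i t $ j = (if j = i then t else x $ j)"
  by (simp add: replace_coord_def)

lemma replace_coord_eq_add_axis: "replace_coord x i t = x + (t - x $ i) *\<^sub>R axis i 1"
  by (simp add: vec_eq_iff replace_coord_component axis_def)

lemma replace_coord_in_strategy_space:
  assumes "x \<in> strategy_space S" "t \<in> S i"
  shows "replace_coord x i t \<in> strategy_space S"
  using assms by (simp add: strategy_space_def replace_coord_component)

lemma DERIV_replace_coord:
  assumes "GDERIV h x :> D"
  shows "((\<lambda>t. h (replace_coord x i t)) has_real_derivative D $ i) (at (x $ i))"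
proof -
  have inner: "((\<lambda>t. replace_coord x i t) has_derivative (\<lambda>t. t *\<^sub>R axis i 1)) (at (x $ i))"
    unfolding replace_coord_eq_add_axis by (auto intro!: derivative_eq_intros)
  have outer: "(h has_derivative (\<lambda>v. v \<bullet> D)) (at (replace_coord x i (x $ i)))"
    using assms unfolding gderiv_def by (simp add: replace_coord_eq_add_axis)
  show ?thesis
    using has_derivative_compose[OF inner outer]
    by (simp add: has_field_derivative_def inner_axis' mult_commute_abs)
qed

lemma partial_deriv_eq_gradient:
  assumes "GDERIV h x :> D"
  shows "partial_deriv i h x = D $ i"
  unfolding partial_deriv_def by (rule DERIV_imp_deriv[OF DERIV_replace_coord[OF assms]])

text \<open>
  Only the direction from \<open>s\<close> towards \<open>t\<close> is explored, since \<open>s\<close> may be an endpoint of the set on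
  which the function is known to be convex or minimal.
\<close>

lemma segment_slope_tendsto:
  fixes \<phi> :: "real \<Rightarrow> real"
  assumes "(\<phi> has_real_derivative d) (at s)"
  shows "((\<lambda>u. (\<phi> (s + u * (t - s)) - \<phi> s) / u) \<longlongrightarrow> d * (t - s)) (at_right 0)"
proof -
  have "((\<lambda>u. s + u * (t - s)) has_real_derivative t - s) (at 0)"
    by (auto intro!: derivative_eq_intros)
  then have "((\<lambda>u. \<phi> (s + u * (t - s))) has_real_derivative d * (t - s)) (at 0)"
    using assms by (intro DERIV_chain2[where g = "\<lambda>u. s + u * (t - s)"]) auto
  then show ?thesis
    by (auto simp: DERIV_def intro: tendsto_mono[rotated] at_le)
qed

lemma convex_tangent_le:
  fixes \<phi> :: "real \<Rightarrow> real"
  assumes conv: "convex_on C \<phi>" and s: "s \<in> C" "t \<in> C"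
    and der: "(\<phi> has_real_derivative d) (at s)"
  shows "d * (t - s) \<le> \<phi> t - \<phi> s"
proof (rule tendsto_upperbound[OF segment_slope_tendsto[OF der]])
  have "\<forall>\<^sub>F u in at_right (0::real). 0 < u \<and> u < 1"
    by (auto simp: eventually_at_right_field intro!: exI[of _ 1])
  then show "\<forall>\<^sub>F u in at_right 0. (\<phi> (s + u * (t - s)) - \<phi> s) / u \<le> \<phi> t - \<phi> s"
  proof eventually_elim
    case (elim u)
    have "\<phi> (s + u * (t - s)) = \<phi> ((1 - u) *\<^sub>R s + u *\<^sub>R t)"
      by (simp add: algebra_simps)
    also have "\<dots> \<le> (1 - u) * \<phi> s + u * \<phi> t"
      using elim s by (intro convex_onD[OF conv]) auto
    finally show ?case
      using elim by (simp add: field_simps)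
  qed
qed simp

lemma min_on_convex_deriv_nonneg:
  fixes \<phi> :: "real \<Rightarrow> real"
  assumes conv: "convex C" and s: "s \<in> C" "t \<in> C"
    and min: "\<And>u. u \<in> C \<Longrightarrow> \<phi> s \<le> \<phi> u"
    and der: "(\<phi> has_real_derivative d) (at s)"
  shows "0 \<le> d * (t - s)"
proof (rule tendsto_lowerbound[OF segment_slope_tendsto[OF der]])
  have "\<forall>\<^sub>F u in at_right (0::real). 0 < u \<and> u < 1"
    by (auto simp: eventually_at_right_field intro!: exI[of _ 1])
  then show "\<forall>\<^sub>F u in at_right 0. 0 \<le> (\<phi> (s + u * (t - s)) - \<phi> s) / u"
  proof eventually_elim
    case (elim u)
    have "(1 - u) *\<^sub>R s + u *\<^sub>R t \<in> C"
      using elim s by (intro convexD_alt[OF conv]) auto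
    then have "\<phi> s \<le> \<phi> (s + u * (t - s))"
      using min by (simp add: algebra_simps)
    then show ?case
      using elim by simp
  qed
qed simp

lemma convex_coordinate_set:
  assumes "convex (strategy_space S)" "strategy_space S \<noteq> {}"
  shows "convex (S i)"
proof -
  obtain y where y: "y \<in> strategy_space S"
    using assms(2) by blast
  have "S i = (\<lambda>x. x $ i) ` strategy_space S"
  proof
    show "S i \<subseteq> (\<lambda>x. x $ i) ` strategy_space S"
    proof
      fix t assume "t \<in> S i"
      then have "replace_coord y i t \<in> strategy_space S"
        by (rule replace_coord_in_strategy_space[OF y])
      then show "t \<in> (\<lambda>x. x $ i) ` strategy_space S"
        by (rule rev_image_eqI) (simp add: replace_coord_component)
    qed
  qed (auto simp: strategy_space_def)
  then show ?thesis
    using convex_linear_image[OF bounded_linear.linear[OF bounded_linear_vec_nth] assms(1)] by simp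
qed

lemma closed_coordinate_set:
  assumes "closed (strategy_space S)" "strategy_space S \<noteq> {}"
  shows "closed (S i)"
proof -
  obtain y where y: "y \<in> strategy_space S"
    using assms(2) by blast
  have "S i = (\<lambda>t. replace_coord y i t) -` strategy_space S"
    using y replace_coord_in_strategy_space[OF y]
    by (auto simp: strategy_space_def replace_coord_component split: if_splits)
  moreover have "continuous_on UNIV (\<lambda>t. replace_coord y i t)"
    unfolding replace_coord_eq_add_axis by (intro continuous_intros)
  ultimately show ?thesis
    using closed_vimage[OF assms(1)] by simp
qed

text \<open>
  Squared distances are sums over the coordinates, so the separate projections of the players together
  minimise the distance to the product set.
\<close>

lemma closest_point_strategy_space:
  fixes S :: "'n::finite \<Rightarrow> real set"
  assumes "convex (strategy_space S)" "closed (strategy_space S)" "strategy_space S \<noteq> {}"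
  shows "(\<chi> i. closest_point (S i) (a $ i)) = closest_point (strategy_space S) a"
proof (rule closest_point_unique[OF assms(1,2)])
  have cl: "closed (S i)" "S i \<noteq> {}" for i
    using closed_coordinate_set[OF assms(2,3)] assms(3) by (auto simp: strategy_space_def)
  show "(\<chi> i. closest_point (S i) (a $ i)) \<in> strategy_space S"
    using cl by (simp add: strategy_space_def closest_point_in_set)
  show "\<forall>z\<in>strategy_space S. dist a (\<chi> i. closest_point (S i) (a $ i)) \<le> dist a z"
  proof
    fix z assume "z \<in> strategy_space S"
    then have "dist (a $ i) (closest_point (S i) (a $ i)) \<le> dist (a $ i) (z $ i)" for i
      using cl by (intro closest_point_le) (auto simp: strategy_space_def)
    then show "dist a (\<chi> i. closest_point (S i) (a $ i)) \<le> dist a z"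
      by (simp add: dist_vec_def L2_set_mono)
  qed
qed

text \<open>
  The Stampacchia variational inequality \<open>VI(C, F)\<close>.
\<close>

definition solves_vi :: "('a::real_inner) set \<Rightarrow> ('a \<Rightarrow> 'a) \<Rightarrow> 'a \<Rightarrow> bool" where
  "solves_vi C F x \<longleftrightarrow> x \<in> C \<and> (\<forall>y\<in>C. 0 \<le> F x \<bullet> (y - x))"

text \<open>
  The projection of \<open>z\<close> onto \<open>C\<close> is the point of \<open>C\<close> from which \<open>z\<close> lies at an obtuse or right
  angle to all of \<open>C\<close>. With \<open>z = x - a * F x\<close> the length \<open>a\<close> drops out of this condition, so a
  solution is fixed under steps of every positive length.
\<close>

lemma closest_point_fixed_iff_solves_vi:
  fixes C :: "'a::euclidean_space set"
  assumes C: "convex C" "closed C" and a: "a > 0" and x: "x \<in> C"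
  shows "closest_point C (x - a *\<^sub>R F x) = x \<longleftrightarrow> solves_vi C F x"
proof
  assume fp: "closest_point C (x - a *\<^sub>R F x) = x"
  have "0 \<le> F x \<bullet> (y - x)" if "y \<in> C" for y
    using closest_point_dot[OF C that, of "x - a *\<^sub>R F x"] a unfolding fp
    by (simp add: zero_le_mult_iff)
  then show "solves_vi C F x"
    using x by (simp add: solves_vi_def)
next
  assume vi: "solves_vi C F x"
  have "dist (x - a *\<^sub>R F x) x \<le> dist (x - a *\<^sub>R F x) z" if "z \<in> C" for z
  proof -
    have "0 \<le> F x \<bullet> (z - x)"
      using vi that by (simp add: solves_vi_def)
    then have "0 \<le> 2 * (a * (F x \<bullet> (z - x)))"
      using a by simp
    moreover have "(norm (x - a *\<^sub>R F x - z))^2 = (norm (a *\<^sub>R F x))^2 + (norm (z - x))^2 + 2 * (a * (F x \<bullet> (z - x)))"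
      unfolding power2_norm_eq_inner by (simp add: algebra_simps inner_commute)
    ultimately have "(norm (a *\<^sub>R F x))^2 \<le> (norm (x - a *\<^sub>R F x - z))^2"
      by simp
    then show ?thesis
      using a by (simp add: dist_norm power2_le_iff_abs_le abs_mult)
  qed
  then show "closest_point C (x - a *\<^sub>R F x) = x"
    using closest_point_unique[OF C x] by metis
qed

text \<open>
  Expand the square: monotonicity bounds the cross term and Lipschitz continuity the quadratic term.
\<close>

lemma gradient_step_contraction:
  fixes F :: "'a::real_inner \<Rightarrow> 'a"
  assumes "(F x - F y) \<bullet> (x - y) \<ge> \<mu> * (norm (x - y))^2" "norm (F x - F y) \<le> L * norm (x - y)" "a \<ge> 0"
  shows "(norm ((x - a *\<^sub>R F x) - (y - a *\<^sub>R F y)))^2 \<le> (1 - 2 * a * \<mu> + a^2 * L^2) * (norm (x - y))^2"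
proof -
  have "(norm ((x - a *\<^sub>R F x) - (y - a *\<^sub>R F y)))^2 =
      (norm (x - y))^2 - 2 * a * ((F x - F y) \<bullet> (x - y)) + a^2 * (norm (F x - F y))^2"
    unfolding power2_norm_eq_inner by (simp add: algebra_simps inner_commute power2_eq_square)
  also have "\<dots> \<le> (norm (x - y))^2 - 2 * a * (\<mu> * (norm (x - y))^2) + a^2 * (L * norm (x - y))^2"
    using assms by (intro add_mono diff_mono mult_left_mono power_mono) auto
  also have "\<dots> = (1 - 2 * a * \<mu> + a^2 * L^2) * (norm (x - y))^2"
    by (simp add: algebra_simps power_mult_distrib)
  finally show ?thesis .
qed

lemma vi_solution_exists:
  fixes F :: "'a::euclidean_space \<Rightarrow> 'a"
  assumes C: "convex C" "closed C" "C \<noteq> {}" and \<mu>: "\<mu> > 0" and L: "L > 0"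
    and mono: "\<And>x y. x \<in> C \<Longrightarrow> y \<in> C \<Longrightarrow> (F x - F y) \<bullet> (x - y) \<ge> \<mu> * (norm (x - y))^2"
    and lip: "\<And>x y. x \<in> C \<Longrightarrow> y \<in> C \<Longrightarrow> norm (F x - F y) \<le> L * norm (x - y)"
  shows "\<exists>x. solves_vi C F x"
proof -
  define L' where "L' = max L \<mu>"
  define a where "a = \<mu> / L'^2"
  have L': "L' > 0" "\<mu> \<le> L'" "L \<le> L'"
    using L by (auto simp: L'_def)
  have a: "a > 0"
    using \<mu> L' by (simp add: a_def)
  define q where "q = 1 - (\<mu> / L')^2"
  have "(\<mu> / L')^2 > 0"
    using \<mu> L' by simp
  moreover have "(\<mu> / L')^2 \<le> 1"
    using \<mu> L' by (simp add: power_le_one)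
  ultimately have q: "0 \<le> q" "q < 1"
    by (simp_all add: q_def)
  have q_eq: "1 - 2 * a * \<mu> + a^2 * L'^2 = q"
    using L' by (simp add: a_def q_def power2_eq_square field_simps)
  define P where "P = (\<lambda>x. closest_point C (x - a *\<^sub>R F x))"
  \<comment> \<open>The factor \<open>1 - 2 * a * \<mu> + a^2 * L'^2\<close> is smallest at this \<open>a\<close>. Enlarging \<open>L\<close> to \<open>L' \<ge> \<mu>\<close>
    makes it nonnegative, so that its square root can serve as the contraction constant.\<close>
  have "\<exists>!x\<in>C. P x = x"
  proof (rule Banach_fix[OF complete_eq_closed[THEN iffD2, OF C(2)], where c = "sqrt q"])
    show "P ` C \<subseteq> C"
      using closest_point_in_set[OF C(2,3)] by (auto simp: P_def)
    fix x y assume xy: "x \<in> C" "y \<in> C"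
    have lip': "norm (F x - F y) \<le> L' * norm (x - y)"
      using lip[OF xy] L'(3) by (meson mult_right_mono norm_ge_zero order_trans)
    have "dist (P x) (P y) \<le> norm ((x - a *\<^sub>R F x) - (y - a *\<^sub>R F y))"
      unfolding P_def using closest_point_lipschitz[OF C] by (metis dist_norm)
    also have "\<dots> \<le> sqrt (q * (norm (x - y))^2)"
      using gradient_step_contraction[OF mono[OF xy] lip', of a] a q_eq
      by (intro real_le_rsqrt) simp
    also have "\<dots> = sqrt q * dist x y"
      by (simp add: real_sqrt_mult dist_norm)
    finally show "dist (P x) (P y) \<le> sqrt q * dist x y" .
  qed (use C q in auto)
  then obtain x where "x \<in> C" "P x = x"
    by blast
  then show ?thesis
    using closest_point_fixed_iff_solves_vi[OF C(1,2) a] unfolding P_def by blast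
qed

lemma vi_solution_unique:
  assumes mono: "\<And>x y. x \<in> C \<Longrightarrow> y \<in> C \<Longrightarrow> (F x - F y) \<bullet> (x - y) \<ge> \<mu> * (norm (x - y))^2"
    and \<mu>: "\<mu> > 0" and x: "solves_vi C F x" and y: "solves_vi C F y"
  shows "x = y"
proof -
  have "0 \<le> F x \<bullet> (y - x)" "0 \<le> F y \<bullet> (x - y)"
    using x y by (auto simp: solves_vi_def)
  then have "(F x - F y) \<bullet> (x - y) \<le> 0"
    by (simp add: algebra_simps)
  then have "\<mu> * (norm (x - y))^2 \<le> 0"
    using mono[of x y] x y by (simp add: solves_vi_def)
  then show ?thesis
    using \<mu> by (simp add: mult_le_0_iff)
qed

text \<open>
  By convexity, player \<open>i\<close> cannot improve at \<open>x\<close> exactly if \<open>F x $ i * (t - x $ i) \<ge> 0\<close> for all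
  \<open>t \<in> S i\<close>. These inequalities add up to the variational inequality on the product set, and are
  recovered from it by moving a single coordinate.
\<close>

lemma nash_equilibrium_iff_solves_vi:
  fixes S :: "'n::finite \<Rightarrow> real set"
  assumes ne: "strategy_space S \<noteq> {}" and conv: "convex (strategy_space S)"
    and grad: "\<And>i y. y \<in> strategy_space S \<Longrightarrow> \<exists>D. GDERIV (J i) y :> D"
    and J_convex: "\<And>i y. y \<in> strategy_space S \<Longrightarrow> convex_on (S i) (\<lambda>t. J i (replace_coord y i t))"
  shows "nash_equilibrium S J x \<longleftrightarrow> solves_vi (strategy_space S) (pseudo_gradient J) x"
proof -
  have der: "((\<lambda>t. J i (replace_coord x i t)) has_real_derivative pseudo_gradient J x $ i) (at (x $ i))"
    if x: "x \<in> strategy_space S" for i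
  proof -
    obtain D where D: "GDERIV (J i) x :> D"
      using grad[OF x] by blast
    show ?thesis
      using DERIV_replace_coord[OF D, of i] partial_deriv_eq_gradient[OF D, of i]
      by (simp add: pseudo_gradient_def)
  qed
  have self: "replace_coord x i (x $ i) = x" for i
    by (simp add: vec_eq_iff replace_coord_component)
  show ?thesis
  proof
    assume nash: "nash_equilibrium S J x"
    then have x: "x \<in> strategy_space S"
      by (simp add: nash_equilibrium_def)
    have "0 \<le> pseudo_gradient J x \<bullet> (y - x)" if y: "y \<in> strategy_space S" for y
    proof -
      have "0 \<le> pseudo_gradient J x $ i * (y $ i - x $ i)" for i
      proof (rule min_on_convex_deriv_nonneg[OF convex_coordinate_set[OF conv ne] _ _ _ der[OF x]])
        show "x $ i \<in> S i" "y $ i \<in> S i"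
          using x y by (auto simp: strategy_space_def)
        fix u assume "u \<in> S i"
        then show "J i (replace_coord x i (x $ i)) \<le> J i (replace_coord x i u)"
          using nash by (simp add: nash_equilibrium_def self)
      qed
      then show ?thesis
        by (simp add: inner_vec_def sum_nonneg)
    qed
    then show "solves_vi (strategy_space S) (pseudo_gradient J) x"
      using x by (simp add: solves_vi_def)
  next
    assume vi: "solves_vi (strategy_space S) (pseudo_gradient J) x"
    then have x: "x \<in> strategy_space S"
      by (simp add: solves_vi_def)
    have "J i x \<le> J i (replace_coord x i t)" if t: "t \<in> S i" for i t
    proof -
      have "0 \<le> pseudo_gradient J x \<bullet> (replace_coord x i t - x)"
        using vi replace_coord_in_strategy_space[OF x t] by (simp add: solves_vi_def)
      also have "\<dots> = pseudo_gradient J x $ i * (t - x $ i)"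
        by (simp add: replace_coord_eq_add_axis inner_axis)
      also have "\<dots> \<le> J i (replace_coord x i t) - J i (replace_coord x i (x $ i))"
        by (rule convex_tangent_le[OF J_convex[OF x] _ t der[OF x]])
          (use x in \<open>simp add: strategy_space_def\<close>)
      finally show ?thesis
        by (simp add: self)
    qed
    then show "nash_equilibrium S J x"
      using x by (simp add: nash_equilibrium_def)
  qed
qed

section \<open>Decay of perturbed linear recursions\<close>

lemma one_plus_powr_minus_ge:
  fixes x p :: real
  assumes "x \<ge> 0" "p \<ge> 0"
  shows "1 - p * x \<le> (1 + x) powr - p"
proof -
  have "1 - p * x \<le> exp (- (p * x))"
    using exp_ge_add_one_self[of "- (p * x)"] by simp
  also have "\<dots> \<le> exp (- (p * ln (1 + x)))"
    using assms ln_add_one_self_le_self[of x] by (simp add: mult_left_mono)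
  also have "\<dots> = (1 + x) powr - p"
    using assms by (simp add: powr_def)
  finally show ?thesis .
qed

text \<open>
  Induction shows \<open>r k \<le> A * v k\<close> for the noise level \<open>v k\<close>. In one step \<open>v\<close> loses at most the fraction
  \<open>p * \<beta> / k\<close>, while the recursion removes the fraction \<open>a / (k + 1)\<close> from \<open>A * v k\<close>. The gap
  \<open>a - p * \<beta>\<close> is split into two halves: one absorbs the noise term, provided \<open>A\<close> is large, and the
  other the lower-order terms, provided \<open>k\<close> is large.
\<close>

lemma perturbed_linear_recursion_rate:
  fixes r :: "nat \<Rightarrow> real" and a p C C' \<beta> :: real
  assumes r: "\<And>k. r k \<ge> 0" and p: "p \<ge> 0" "\<beta> > 0" and ap: "a > p * \<beta>" and C: "C \<ge> 0" "C' \<ge> 0"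
    and rec: "\<forall>\<^sub>F k in sequentially. r (Suc k) \<le> (1 - a / (real k + 1) + C / (real k + 1)^2) * r k
         + C' / (real k + 1) * (ln (real k) / real k powr \<beta>) powr p"
  shows "\<exists>A>0. \<exists>K. \<forall>k\<ge>K. r k \<le> A * (ln (real k) / real k powr \<beta>) powr p"
proof -
  define v where "v = (\<lambda>k::nat. (ln (real k) / real k powr \<beta>) powr p)"
  define \<kappa> where "\<kappa> = (a - p * \<beta>) / 2"
  have a_eq: "a = p * \<beta> + 2 * \<kappa>"
    using \<kappa>_def by (simp add: field_simps)
  have \<kappa>: "\<kappa> > 0"
    using ap by (simp add: \<kappa>_def)
  have lim: "(\<lambda>k. p * \<beta> / real k + C / (real k + 1)) \<longlonglongrightarrow> 0"
    by real_asymp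
  have lim1: "(\<lambda>k. a / (real k + 1)) \<longlonglongrightarrow> 0"
    by real_asymp
  have "\<forall>\<^sub>F k in sequentially. p * \<beta> / real k + C / (real k + 1) < \<kappa> \<and> a / (real k + 1) < 1 \<and> k \<ge> 2 \<and>
     r (Suc k) \<le> (1 - a / (real k + 1) + C / (real k + 1)^2) * r k + C' / (real k + 1) * v k"
    using order_tendstoD(2)[OF lim \<kappa>] order_tendstoD(2)[OF lim1 zero_less_one] eventually_ge_at_top[of 2] rec
    by eventually_elim (simp add: v_def)
  then obtain K where K: "\<And>k. k \<ge> K \<Longrightarrow> p * \<beta> / real k + C / (real k + 1) < \<kappa>"
     "\<And>k. k \<ge> K \<Longrightarrow> a / (real k + 1) < 1" "\<And>k. k \<ge> K \<Longrightarrow> k \<ge> 2"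
     "\<And>k. k \<ge> K \<Longrightarrow> r (Suc k) \<le> (1 - a / (real k + 1) + C / (real k + 1)^2) * r k + C' / (real k + 1) * v k"
    unfolding eventually_sequentially by blast
  have v_pos: "v k > 0" if "k \<ge> K" for k
    using K(3)[OF that] by (simp add: v_def)
  have v_step: "(1 - p * \<beta> / real k) * v k \<le> v (Suc k)" if "k \<ge> K" for k
  proof -
    have k: "k \<ge> 2"
      using K(3)[OF that] .
    have "(1 - p * \<beta> / real k) * v k \<le> (1 + 1 / real k) powr - (p * \<beta>) * v k"
      using one_plus_powr_minus_ge[of "1 / real k" "p * \<beta>"] p v_pos[OF that] 
      by (intro mult_right_mono) auto
    also have "(1 + 1 / real k) = real (Suc k) / real k"
      using k by (simp add: field_simps)
    also have "(real (Suc k) / real k) powr - (p * \<beta>) * v k = (ln (real k) / real (Suc k) powr \<beta>) powr p"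
      using k by (simp add: v_def powr_divide powr_powr powr_minus field_simps)
    also have "\<dots> \<le> v (Suc k)"
      unfolding v_def using k p by (intro powr_mono2 divide_right_mono) auto
    finally show ?thesis .
  qed
  define A where "A = max (C' / \<kappa>) (r K / v K) + 1"
  have A: "A > 0" "C' \<le> A * \<kappa>" "r K \<le> A * v K"
  proof -
    have "C' / \<kappa> \<ge> 0"
      using C \<kappa> by simp
    then show "A > 0"
      by (simp add: A_def)
    have "C' / \<kappa> \<le> A" "r K / v K \<le> A"
      by (simp_all add: A_def)
    then show "C' \<le> A * \<kappa>" "r K \<le> A * v K"
      using \<kappa> v_pos[of K] by (simp_all add: field_simps)
  qed
  have regroup: "(1 - a / N + C / N^2) * (A * w) + A * \<kappa> / N * w = A * w * (1 - (a - \<kappa> - C / N) / N)"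
    for N w :: real
    by (simp add: power2_eq_square diff_divide_distrib add_divide_distrib algebra_simps)
  have "r k \<le> A * v k" if "k \<ge> K" for k
    using that
  proof (induction k rule: dec_induct)
    case base
    then show ?case using A by simp
  next
    case (step k)
    have k: "k \<ge> 2"
      using K(3) step by simp
    have fac: "0 \<le> 1 - a / (real k + 1) + C / (real k + 1)^2"
      using K(2)[of k] step C by (simp add: add_nonneg_nonneg)
    have "r (Suc k) \<le> (1 - a / (real k + 1) + C / (real k + 1)^2) * r k + C' / (real k + 1) * v k"
      using K(4) step by simp
    also have "\<dots> \<le> (1 - a / (real k + 1) + C / (real k + 1)^2) * (A * v k) + A * \<kappa> / (real k + 1) * v k"
      using step fac A(2) v_pos[of k] by (intro add_mono mult_left_mono mult_right_mono divide_right_mono) auto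
    also have "\<dots> = A * v k * (1 - (a - \<kappa> - C / (real k + 1)) / (real k + 1))"
      by (rule regroup)
    also have "\<dots> \<le> A * v k * (1 - p * \<beta> / real k)"
    proof (intro mult_left_mono)
      have "p * \<beta> / real k * (real k + 1) = p * \<beta> + p * \<beta> / real k"
        using k by (simp add: field_simps)
      also have "\<dots> \<le> a - \<kappa> - C / (real k + 1)"
        using K(1)[OF step(1)] a_eq by linarith
      finally show "1 - (a - \<kappa> - C / (real k + 1)) / (real k + 1) \<le> 1 - p * \<beta> / real k"
        by (simp add: pos_le_divide_eq)
    qed (use A v_pos[of k] step in auto)
    also have "\<dots> \<le> A * v (Suc k)"
      using v_step[of k] step A(1) by (simp add: mult.commute mult.left_commute)
    finally show ?case .
  qed
  then show ?thesis
    using A(1) unfolding v_def by blast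
qed

section \<open>Projected gradient steps with noise\<close>

text \<open>
  Compares the noisy step from \<open>x\<close> with the exact step from \<open>xs\<close>, which does not move \<open>xs\<close>.
\<close>

lemma projected_noisy_gradient_step:
  fixes F :: "'a::euclidean_space \<Rightarrow> 'a"
  assumes C: "convex C" "closed C" and vi: "solves_vi C F xs" and x: "x \<in> C" and a: "a > 0" "a * \<mu> \<le> 1"
    and mono: "(F x - F xs) \<bullet> (x - xs) \<ge> \<mu> * (norm (x - xs))^2"
    and lip: "norm (F x - F xs) \<le> L * norm (x - xs)"
  shows "norm (closest_point C (x - a *\<^sub>R (F x + e)) - xs) \<le> (1 - a * \<mu> + a^2 * L^2 / 2) * norm (x - xs) + a * norm e"
proof -
  define t where "t = 1 - 2 * a * \<mu> + a^2 * L^2"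
  have xs: "xs \<in> C"
    using vi by (simp add: solves_vi_def)
  have "norm (closest_point C (x - a *\<^sub>R (F x + e)) - xs)
      = dist (closest_point C (x - a *\<^sub>R (F x + e))) (closest_point C (xs - a *\<^sub>R F xs))"
    using closest_point_fixed_iff_solves_vi[OF C a(1) xs, of F] vi by (simp add: dist_norm)
  also have "\<dots> \<le> dist (x - a *\<^sub>R (F x + e)) (xs - a *\<^sub>R F xs)"
    using closest_point_lipschitz[OF C] xs by blast
  also have "\<dots> = norm (((x - a *\<^sub>R F x) - (xs - a *\<^sub>R F xs)) - a *\<^sub>R e)"
    by (simp add: dist_norm algebra_simps)
  also have "\<dots> \<le> norm ((x - a *\<^sub>R F x) - (xs - a *\<^sub>R F xs)) + norm (a *\<^sub>R e)"
    by (rule norm_triangle_ineq4)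
  also have "norm (a *\<^sub>R e) = a * norm e"
    using a by simp
  finally have step: "norm (closest_point C (x - a *\<^sub>R (F x + e)) - xs)
      \<le> norm ((x - a *\<^sub>R F x) - (xs - a *\<^sub>R F xs)) + a * norm e" .
  \<comment> \<open>the inequality \<open>sqrt t \<le> (1 + t) / 2\<close>, squared, since \<open>t\<close> may be negative when \<open>x = xs\<close>\<close>
  have "(norm ((x - a *\<^sub>R F x) - (xs - a *\<^sub>R F xs)))^2 \<le> t * (norm (x - xs))^2"
    unfolding t_def by (rule gradient_step_contraction[OF mono lip]) (use a in simp)
  also have "\<dots> \<le> ((1 + t) / 2)^2 * (norm (x - xs))^2"
  proof (rule mult_right_mono)
    have "((1 + t) / 2)^2 - t = ((1 - t) / 2)^2"
      by (simp add: power2_eq_square field_simps)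
    then show "t \<le> ((1 + t) / 2)^2"
      by (metis diff_ge_0_iff_ge zero_le_power2)
  qed simp
  also have "\<dots> = ((1 + t) / 2 * norm (x - xs))^2"
    by (rule power_mult_distrib[symmetric])
  also have "(1 + t) / 2 = 1 - a * \<mu> + a^2 * L^2 / 2"
    by (simp add: t_def field_simps)
  finally have "norm ((x - a *\<^sub>R F x) - (xs - a *\<^sub>R F xs)) \<le> (1 - a * \<mu> + a^2 * L^2 / 2) * norm (x - xs)"
    by (rule power2_le_imp_le) (use a in \<open>simp add: add_nonneg_nonneg\<close>)
  then show ?thesis
    using step by linarith
qed

lemma projected_noisy_gradient_rate:
  fixes F :: "'a::euclidean_space \<Rightarrow> 'a" and y e :: "nat \<Rightarrow> 'a"
  assumes C: "convex C" "closed C" and vi: "solves_vi C F xs" and y: "\<And>k. y k \<in> C"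
    and mono: "\<And>x y. x \<in> C \<Longrightarrow> y \<in> C \<Longrightarrow> (F x - F y) \<bullet> (x - y) \<ge> \<mu> * (norm (x - y))^2"
    and lip: "\<And>x y. x \<in> C \<Longrightarrow> y \<in> C \<Longrightarrow> norm (F x - F y) \<le> L * norm (x - y)"
    and b: "b > 0" and p: "p \<ge> 0" "\<beta> > 0" "\<mu> * b > p * \<beta>" and E: "E \<ge> 0"
    and step: "\<And>k. y (Suc k) = closest_point C (y k - (b / (real k + 1)) *\<^sub>R (F (y k) + e k))"
    and noise: "\<forall>\<^sub>F k in sequentially. norm (e k) \<le> E * (ln (real k) / real k powr \<beta>) powr p"
  shows "\<exists>A>0. \<exists>K. \<forall>k\<ge>K. norm (y k - xs) \<le> A * (ln (real k) / real k powr \<beta>) powr p"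
proof (rule perturbed_linear_recursion_rate[where a = "\<mu> * b" and C = "b^2 * L^2 / 2" and C' = "b * E"])
  have xs: "xs \<in> C"
    using vi by (simp add: solves_vi_def)
  have "(\<lambda>k. b / (real k + 1) * \<mu>) \<longlonglongrightarrow> 0"
    by real_asymp
  then have "\<forall>\<^sub>F k in sequentially. b / (real k + 1) * \<mu> < 1"
    by (rule order_tendstoD) simp
  then show "\<forall>\<^sub>F k in sequentially. norm (y (Suc k) - xs) \<le>
      (1 - \<mu> * b / (real k + 1) + b^2 * L^2 / 2 / (real k + 1)^2) * norm (y k - xs) +
      b * E / (real k + 1) * (ln (real k) / real k powr \<beta>) powr p"
    using noise
  proof eventually_elim
    case (elim k)
    have "norm (y (Suc k) - xs) \<le>
        (1 - b / (real k + 1) * \<mu> + (b / (real k + 1))^2 * L^2 / 2) * norm (y k - xs) + b / (real k + 1) * norm (e k)"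
      unfolding step using elim(1) b
      by (intro projected_noisy_gradient_step[OF C vi y] mono lip y xs) auto
    also have "b / (real k + 1) * norm (e k) \<le> b / (real k + 1) * (E * (ln (real k) / real k powr \<beta>) powr p)"
      using elim(2) b by (intro mult_left_mono) auto
    finally show ?case
      by (simp add: power_divide mult_ac)
  qed
qed (use p b E in auto)

text \<open>
  Logarithms grow more slowly than powers, so the logarithmic entry of the minimum is the smaller one
  for large \<open>k\<close>. Then there are at least two samples per block, hence rounding down costs at most half
  of the block size.
\<close>

lemma block_parameters_eventually:
  fixes \<beta> :: real and c :: nat and \<gamma> :: "nat \<Rightarrow> real" and m nb s :: "nat \<Rightarrow> nat"
  assumes "\<beta> > 0" "c \<ge> 1"
    and m_eq: "\<And>k. m k = c * nat \<lceil>(real k + 1) powr \<beta>\<rceil>"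
    and \<gamma>_eq: "\<And>k. \<gamma> k = 1 / (real k + 1)^2"
    and nb_eq: "\<And>k. nb k =
          max 1 (nat \<lfloor>min (8 * ln (exp (1/8) * inverse (\<gamma> k))) (real (m k) / 2)\<rfloor>)"
    and s_eq: "\<And>k. s k = nat \<lfloor>real (m k) / real (nb k)\<rfloor>"
  shows "\<forall>\<^sub>F k in sequentially. s k > 0 \<and> 16 * ln (real k + 1) \<le> real (nb k) \<and>
    real k powr \<beta> / (66 * ln (real k)) \<le> real (s k)"
proof -
  have "\<forall>\<^sub>F k in sequentially. 1 + 16 * ln (real k + 1) \<le> (real k + 1) powr \<beta> / 2"
    using \<open>\<beta> > 0\<close> by real_asymp
  then show ?thesis
    using eventually_ge_at_top[of 3]
  proof eventually_elim
    case (elim k)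
    define u where "u = 1 + 16 * ln (real k + 1)"
    have u: "u \<ge> 1"
      by (simp add: u_def)
    have "(real k + 1) powr \<beta> \<le> real (nat \<lceil>(real k + 1) powr \<beta>\<rceil>)"
      by (rule real_nat_ceiling_ge)
    also have "\<dots> \<le> real (m k)"
      using \<open>c \<ge> 1\<close> by (simp add: m_eq)
    finally have m: "(real k + 1) powr \<beta> \<le> real (m k)" .
    have arg: "8 * ln (exp (1/8) * inverse (\<gamma> k)) = u"
      by (simp add: \<gamma>_eq u_def ln_mult ln_realpow)
    have "min u (real (m k) / 2) = u"
      using elim(1) m unfolding u_def by linarith
    moreover have one: "1 \<le> nat \<lfloor>u\<rfloor>"
      using u by linarith
    ultimately have nb: "nb k = nat \<lfloor>u\<rfloor>"
      unfolding nb_eq arg by (simp only: max_absorb2)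
    have nb_bounds: "real (nb k) \<le> u" "u - 1 \<le> real (nb k)"
      unfolding nb using u by linarith+
    have nb_ge: "real (nb k) \<ge> 1"
      using one unfolding nb by simp
    have "real (nb k) \<le> real (m k) / 2"
      using nb_bounds(1) elim(1) m unfolding u_def by linarith
    then have ratio: "2 \<le> real (m k) / real (nb k)"
      using nb_ge by (simp add: field_simps)
    have half: "q / 2 \<le> real (nat \<lfloor>q\<rfloor>)" if "2 \<le> q" for q :: real
      using that by linarith
    have s: "real (m k) / real (nb k) / 2 \<le> real (s k)"
      unfolding s_eq by (rule half[OF ratio])
    have "ln 3 \<ge> (1::real)"
      using exp_le by (subst ln_ge_iff) auto
    moreover have "ln 3 \<le> ln (real k)"
      using elim by simp
    ultimately have ln1: "1 \<le> ln (real k)"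
      by linarith
    have "3 * real k \<le> real k * real k"
      using elim by (intro mult_right_mono) auto
    then have "real k + 1 \<le> real k * real k"
      using elim by linarith
    then have "ln (real k + 1) \<le> ln (real k * real k)"
      using elim by (subst ln_le_cancel_iff) auto
    then have "ln (real k + 1) \<le> 2 * ln (real k)"
      using elim by (simp add: ln_mult)
    then have u_le: "u \<le> 33 * ln (real k)"
      using ln1 unfolding u_def by linarith
    have "real k powr \<beta> / (66 * ln (real k)) \<le> (real k + 1) powr \<beta> / (2 * u)"
      using u_le u ln1 \<open>\<beta> > 0\<close> by (intro frac_le powr_mono2) auto
    also have "\<dots> \<le> real (m k) / (2 * real (nb k))"
      using m nb_bounds nb_ge u by (intro frac_le) auto
    finally have "real k powr \<beta> / (66 * ln (real k)) \<le> real (s k)"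
      using s by simp
    moreover have "s k > 0"
      using s ratio by (cases "s k") auto
    ultimately show ?case
      using nb_bounds(2) by (simp add: u_def)
  qed
qed

text \<open>
  The bound is at most \<open>(1/2) powr (8 * ln (k + 1))\<close>, which is \<open>(k + 1) powr (- 8 * ln 2)\<close> and
  at most \<open>1 / (k + 1)^2\<close> because \<open>ln 2 \<ge> 1/4\<close>.
\<close>

lemma failure_bound_summable:
  fixes nb :: "nat \<Rightarrow> nat" and P :: "nat \<Rightarrow> real"
  assumes nb: "\<forall>\<^sub>F k in sequentially. 16 * ln (real k + 1) \<le> real (nb k)"
    and P: "\<And>k. 0 \<le> P k" "\<forall>\<^sub>F k in sequentially. P k \<le> (1 / 2) powr (real (nb k) / 2)"
  shows "summable P"
proof (rule summable_comparison_test_ev)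
  have "summable (\<lambda>k. inverse ((real k)^2))"
    by (rule inverse_power_summable) simp
  then show "summable (\<lambda>k. inverse ((real (Suc k))^2))"
    by (subst summable_Suc_iff)
  show "\<forall>\<^sub>F k in sequentially. norm (P k) \<le> inverse ((real (Suc k))^2)"
    using nb P(2)
  proof eventually_elim
    case (elim k)
    have ln: "0 \<le> ln (real k + 1)"
      by simp
    have "(1 / 2) powr (real (nb k) / 2) \<le> (1 / 2) powr (8 * ln (real k + 1))"
      using elim(1) by (intro powr_mono') auto
    also have "\<dots> = exp (- (8 * ln 2 * ln (real k + 1)))"
      by (simp add: powr_def ln_div)
    also have "\<dots> \<le> exp (- (2 * ln (real k + 1)))"
      using ln ln2_ge_two_thirds by (simp add: mult_right_mono)
    also have "\<dots> = inverse ((real (Suc k))^2)"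
      by (simp add: exp_minus exp_double add.commute)
    finally show ?case
      using elim(2) P(1)[of k] by simp
  qed
qed

section \<open>The history of the algorithm\<close>

lemma space_past: "space (past M x0 m X k) = space M"
  by (simp add: past_def space_measure_of_conv)

lemma sets_past: "sets (past M x0 m X k) = sigma_sets (space M)
     ({x0 -` A \<inter> space M | A. A \<in> sets borel} \<union>
      {X i l j -` A \<inter> space M | i l j A. l < k \<and> j \<in> {1..m l} \<and> A \<in> sets borel})"
  unfolding past_def by (rule sets_measure_of) auto

lemma subalgebra_past:
  assumes "x0 \<in> borel_measurable M" "\<And>i l j. j \<in> {1..m l} \<Longrightarrow> X i l j \<in> borel_measurable M"
  shows "subalgebra M (past M x0 m X k)"
  unfolding subalgebra_def sets_past
  using assms by (auto simp: space_past intro!: sets.sigma_sets_subset)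

lemma past_mono:
  assumes "k \<le> k'"
  shows "sets (past M x0 m X k) \<subseteq> sets (past M x0 m X k')"
  unfolding sets_past by (rule sigma_sets_mono') (use assms in \<open>blast intro: less_le_trans\<close>)

lemma measurable_initial_past:
  fixes x0 :: "'w \<Rightarrow> real^'n"
  shows "x0 \<in> borel_measurable (past M x0 m X k)"
proof (rule measurableI)
  fix A :: "(real^'n) set" assume "A \<in> sets borel"
  then show "x0 -` A \<inter> space (past M x0 m X k) \<in> sets (past M x0 m X k)"
    unfolding space_past sets_past by (intro sigma_sets.Basic UnI1 CollectI exI[of _ A] conjI refl)
qed simp

lemma measurable_sample_past:
  assumes "l < k" "j \<in> {1..m l}"
  shows "X i l j \<in> borel_measurable (past M x0 m X k)"
proof (rule measurableI)
  fix A :: "real set" assume "A \<in> sets borel"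
  then show "X i l j -` A \<inter> space (past M x0 m X k) \<in> sets (past M x0 m X k)"
    unfolding space_past sets_past using assms
    by (intro sigma_sets.Basic UnI2 CollectI exI[of _ i] exI[of _ l] exI[of _ j] exI[of _ A] conjI refl)
qed simp

lemma space_step_samples: "space (step_samples M m X i k) = space M"
  by (simp add: step_samples_def space_measure_of_conv)

lemma sets_step_samples: "sets (step_samples M m X i k) = sigma_sets (space M)
     {X i k j -` A \<inter> space M | j A. j \<in> {1..m k} \<and> A \<in> sets borel}"
  unfolding step_samples_def by (rule sets_measure_of) auto

lemma subalgebra_step_samples:
  assumes "\<And>j. j \<in> {1..m k} \<Longrightarrow> X i k j \<in> borel_measurable M"
  shows "subalgebra M (step_samples M m X i k)"
  unfolding subalgebra_def sets_step_samples
  using assms by (auto simp: space_step_samples intro!: sets.sigma_sets_subset)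

lemma measurable_step_sample:
  assumes "j \<in> {1..m k}"
  shows "X i k j \<in> borel_measurable (step_samples M m X i k)"
proof (rule measurableI)
  fix A :: "real set" assume "A \<in> sets borel"
  then show "X i k j -` A \<inter> space (step_samples M m X i k) \<in> sets (step_samples M m X i k)"
    unfolding space_step_samples sets_step_samples using assms
    by (intro sigma_sets.Basic CollectI exI[of _ j] exI[of _ A] conjI refl)
qed simp

lemma borel_measurable_vec_lambda:
  fixes h :: "'n::finite \<Rightarrow> 'w \<Rightarrow> real"
  assumes "\<And>i. h i \<in> borel_measurable N"
  shows "(\<lambda>\<omega>. \<chi> i. h i \<omega>) \<in> borel_measurable N"
  by (rule borel_measurable_euclidean_space[THEN iffD2]) (use assms in \<open>auto simp: Basis_vec_def inner_axis\<close>)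

section \<open>The convergence rate\<close>

theorem theorem2:
  fixes M :: "'w measure"
    and S :: "'n::finite \<Rightarrow> real set"
    and U :: "(real^'n) set"
    and f :: "'n \<Rightarrow> real^'n \<Rightarrow> real \<Rightarrow> real"
    and D :: "'n \<Rightarrow> real measure"
    and J :: "'n \<Rightarrow> real^'n \<Rightarrow> real"
    and X :: "'n \<Rightarrow> nat \<Rightarrow> nat \<Rightarrow> 'w \<Rightarrow> real"
    and x :: "nat \<Rightarrow> 'w \<Rightarrow> real^'n"
    and g :: "'n \<Rightarrow> nat \<Rightarrow> nat \<Rightarrow> 'w \<Rightarrow> real"
    and \<epsilon> :: "'n \<Rightarrow> nat \<Rightarrow> nat \<Rightarrow> 'w \<Rightarrow> real"
    and B :: "'n \<Rightarrow> nat \<Rightarrow> nat \<Rightarrow> nat set"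
    and \<alpha> \<gamma> :: "nat \<Rightarrow> real"
    and m nb s :: "nat \<Rightarrow> nat"
    and \<mu> L \<delta> \<nu> b \<beta> :: real
    and c :: nat
  assumes players: "CARD('n) > 1"
    \<comment> \<open>the game\<close>
    and law: "\<And>i. prob_space (D i)" "\<And>i. sets (D i) = sets borel"
    and domain: "open U" "strategy_space S \<subseteq> U"
    and cost_integrable: "\<And>i y. y \<in> U \<Longrightarrow> integrable (D i) (f i y)"
    and J_eq: "\<And>i y. J i y = (\<integral>z. f i y z \<partial>D i)"
    and sample_gradient_exists: "\<And>i y. y \<in> strategy_space S \<Longrightarrow>
          AE z in D i. (\<lambda>t. f i (replace_coord y i t) z) differentiable at (y $ i)"
    and sample_gradient_measurable: "\<And>i. (\<lambda>(y, z). partial_deriv i (\<lambda>y. f i y z) y)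
          \<in> borel_measurable (restrict_space borel (strategy_space S) \<Otimes>\<^sub>M borel)"
    \<comment> \<open>compactness, smoothness, convexity, monotonicity\<close>
    and "strategy_space S \<noteq> {}" "convex (strategy_space S)" "compact (strategy_space S)"
    and J_C1: "\<And>i. \<exists>G. (\<forall>y\<in>U. GDERIV (J i) y :> G y) \<and> continuous_on U G"
    and J_convex: "\<And>i y. y \<in> strategy_space S \<Longrightarrow>
          convex_on (S i) (\<lambda>t. J i (replace_coord y i t))"
    and strongly_monotone: "\<mu> > 0" "\<And>y z. y \<in> strategy_space S \<Longrightarrow> z \<in> strategy_space S \<Longrightarrow>
          (pseudo_gradient J y - pseudo_gradient J z) \<bullet> (y - z) \<ge> \<mu> * (norm (y - z))^2"
    and lipschitz: "L > 0" "L-lipschitz_on (strategy_space S) (pseudo_gradient J)"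
    \<comment> \<open>parameters; the max 1 in nb covers the case where the formula gives 0, and then nb = s = 1\<close>
    and "b > 0" "\<beta> > 0" "c \<ge> 1" "1 < \<delta>" "\<delta> \<le> 2" "\<nu> > 0"
    and b_large: "\<mu> * b > max 1 (\<beta> * (2 * (\<delta> - 1) / \<delta>))"
    and \<alpha>_eq: "\<And>k. \<alpha> k = b / (real k + 1)"
    and m_eq: "\<And>k. m k = c * nat \<lceil>(real k + 1) powr \<beta>\<rceil>"
    and \<gamma>_eq: "\<And>k. \<gamma> k = 1 / (real k + 1)^2"
    and nb_eq: "\<And>k. nb k =
          max 1 (nat \<lfloor>min (8 * ln (exp (1/8) * inverse (\<gamma> k))) (real (m k) / 2)\<rfloor>)"
    and s_eq: "\<And>k. s k = nat \<lfloor>real (m k) / real (nb k)\<rfloor>"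
    \<comment> \<open>sampling\<close>
    and prob: "prob_space M"
    and sample_law: "\<And>i k j. j \<in> {1..m k} \<Longrightarrow> distr M borel (X i k j) = D i"
    and sample_indep: "\<And>i k. prob_space.indep_vars M (\<lambda>_. borel) (X i k) {1..m k}"
    and past_indep: "\<And>i k. prob_space.indep_set M
          (sets (past M (x 0) m X k)) (sets (step_samples M m X i k))"
    \<comment> \<open>the algorithm\<close>
    and x0: "x 0 \<in> borel_measurable M" "\<And>\<omega>. \<omega> \<in> space M \<Longrightarrow> x 0 \<omega> \<in> strategy_space S"
    and g_eq: "\<And>i k j \<omega>. g i k j \<omega> = partial_deriv i (\<lambda>y. f i y (X i k j \<omega>)) (x k \<omega>)"
    and blocks: "\<And>i k. disjoint_family_on (B i k) {1..nb k}"
      "\<And>i k l. l \<in> {1..nb k} \<Longrightarrow> B i k l \<subseteq> {1..m k} \<and> card (B i k l) = s k"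
    and step: "\<And>k \<omega>. \<omega> \<in> space M \<Longrightarrow> x (Suc k) \<omega> = (\<chi> i. closest_point (S i)
          (x k \<omega> $ i - \<alpha> k *
             median (map (\<lambda>l. 1 / real (s k) * (\<Sum>j\<in>B i k l. g i k j \<omega>)) [1..<nb k + 1])))"
    \<comment> \<open>gradient noise\<close>
    and \<epsilon>_eq: "\<And>i k j \<omega>. \<epsilon> i k j \<omega> = g i k j \<omega> - partial_deriv i (J i) (x k \<omega>)"
    and noise_mean: "\<And>i k j. j \<in> {1..m k} \<Longrightarrow>
          AE \<omega> in M. real_cond_exp M (past M (x 0) m X k) (\<epsilon> i k j) \<omega> = 0"
    and noise_moment: "\<And>i k j. j \<in> {1..m k} \<Longrightarrow>
          AE \<omega> in M. nn_cond_exp M (past M (x 0) m X k) (\<lambda>\<omega>. ennreal (\<bar>\<epsilon> i k j \<omega>\<bar> powr \<delta>)) \<omega>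
            \<le> ennreal (\<nu> powr \<delta>)"
  shows "(\<exists>!xs. nash_equilibrium S J xs) \<and>
    (\<forall>xs. nash_equilibrium S J xs \<longrightarrow>
      (AE \<omega> in M. \<exists>A3>0. \<exists>Kr::nat.
        (\<forall>k\<ge>Kr. (norm (x k \<omega> - xs))^2
            \<le> A3 * max (1 / real k) ((ln (real k) / real k powr \<beta>) powr (2 * (\<delta> - 1) / \<delta>))) \<and>
        (\<delta> = 2 \<and> \<beta> \<ge> 1 \<longrightarrow>
          (\<forall>k\<ge>Kr. (norm (x k \<omega> - xs))^2 \<le> A3 * (ln (real k) / real k)))))"
proof -
  interpret prob_space M
    by (rule prob)
  let ?C = "strategy_space S" and ?F = "pseudo_gradient J"
  have C: "convex ?C" "closed ?C" "?C \<noteq> {}"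
    using \<open>strategy_space S \<noteq> {}\<close> \<open>convex (strategy_space S)\<close> \<open>compact (strategy_space S)\<close>
    by (auto intro: compact_imp_closed)
  have grad: "\<exists>D. GDERIV (J i) y :> D" if "y \<in> ?C" for i y
    using J_C1[of i] domain(2) that by blast
  have nash_iff: "nash_equilibrium S J xs \<longleftrightarrow> solves_vi ?C ?F xs" for xs
    by (rule nash_equilibrium_iff_solves_vi[OF C(3,1) grad J_convex])
  have lip: "norm (?F y - ?F z) \<le> L * norm (y - z)" if "y \<in> ?C" "z \<in> ?C" for y z
    using lipschitz_onD[OF lipschitz(2) that] by (simp add: dist_norm)
  have unique: "\<exists>!xs. nash_equilibrium S J xs"
    unfolding nash_iff
    using vi_solution_exists[OF C strongly_monotone(1) lipschitz(1) strongly_monotone(2) lip]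
      vi_solution_unique[OF strongly_monotone(2) strongly_monotone(1)]
    by blast

  have X_meas: "X i k j \<in> borel_measurable M" if "j \<in> {1..m k}" for i k j
    using sample_indep[of i k] that by (auto simp: indep_vars_def)
  have sub: "subalgebra M (past M (x 0) m X k)" for k
    by (rule subalgebra_past[OF x0(1) X_meas])
  have sub': "subalgebra M (step_samples M m X i k)" for i k
    by (rule subalgebra_step_samples[OF X_meas])
  have nb_pos: "nb k > 0" for k
    unfolding nb_eq by simp
  have in_block: "j \<in> {1..m k}" if "l \<in> {1..nb k}" "j \<in> B i k l" for i j k l
    using blocks(2)[OF that(1)] that(2) by blast
  define ghat where "ghat = (\<lambda>i k \<omega>. median (map (\<lambda>l. 1 / real (s k) * (\<Sum>j\<in>B i k l. g i k j \<omega>)) [1..<nb k + 1]))"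
  have step': "x (Suc k) \<omega> = closest_point ?C (x k \<omega> - \<alpha> k *\<^sub>R (\<chi> i. ghat i k \<omega>))" if "\<omega> \<in> space M" for k \<omega>
    unfolding step[OF that] closest_point_strategy_space[OF C, symmetric] by (simp add: ghat_def)
  have x_in: "x k \<omega> \<in> ?C" if "\<omega> \<in> space M" for k \<omega>
  proof (cases k)
    case 0
    then show ?thesis
      using x0(2)[OF that] by simp
  next
    case (Suc k')
    then show ?thesis
      using step'[OF that, of k'] closest_point_in_set[OF C(2,3)] by simp
  qed

  have sample_gradient: "(\<lambda>\<omega>. partial_deriv i (\<lambda>y. f i y (Z \<omega>)) (Y \<omega>)) \<in> borel_measurable N"
    if "Y \<in> borel_measurable N" "Z \<in> borel_measurable N" "\<And>\<omega>. \<omega> \<in> space N \<Longrightarrow> Y \<omega> \<in> ?C"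
    for i and N :: "'v measure" and Y Z
  proof -
    have "(\<lambda>\<omega>. (Y \<omega>, Z \<omega>)) \<in> measurable N (restrict_space borel ?C \<Otimes>\<^sub>M borel)"
      using that by (intro measurable_Pair measurable_restrict_space2) auto
    from measurable_compose[OF this sample_gradient_measurable[of i]] show ?thesis
      by simp
  qed
  have x_adapted: "x k \<in> borel_measurable (past M (x 0) m X k)" for k
  proof (induction k)
    case 0
    show ?case
      by (rule measurable_initial_past)
  next
    case (Suc k)
    let ?P = "past M (x 0) m X (Suc k)"
    have xk: "x k \<in> borel_measurable ?P"
      using Suc past_mono[of k "Suc k" M "x 0" m X]
      by (auto simp: measurable_def space_past)
    have "g i k j \<in> borel_measurable ?P" if "j \<in> {1..m k}" for i j
      unfolding g_eq[abs_def]
      by (rule sample_gradient[OF xk measurable_sample_past])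
        (use that x_in in \<open>auto simp: space_past\<close>)
    then have "(\<lambda>\<omega>. 1 / real (s k) * (\<Sum>j\<in>B i k l. g i k j \<omega>)) \<in> borel_measurable ?P"
      if "l \<in> {1..nb k}" for i l
      using blocks(2)[OF that, of i] by (intro borel_measurable_times borel_measurable_sum) auto
    then have ghat_meas: "ghat i k \<in> borel_measurable ?P" for i
      unfolding ghat_def using nb_pos[of k] by (intro borel_measurable_median) auto
    have "(\<lambda>\<omega>. x k \<omega> - \<alpha> k *\<^sub>R (\<chi> i. ghat i k \<omega>)) \<in> borel_measurable ?P"
      by (intro borel_measurable_diff borel_measurable_scaleR borel_measurable_vec_lambda
          borel_measurable_const xk ghat_meas)
    then have "(\<lambda>\<omega>. closest_point ?C (x k \<omega> - \<alpha> k *\<^sub>R (\<chi> i. ghat i k \<omega>))) \<in> borel_measurable ?P"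
      by (rule measurable_compose) (intro borel_measurable_continuous_onI continuous_on_closest_point C)
    then show ?case
      by (rule measurable_cong[THEN iffD2, rotated]) (simp add: step' space_past)
  qed

  \<comment> \<open>the gradient error as a function of the past, through \<open>x k\<close>, and of one fresh sample\<close>
  define \<Phi> where "\<Phi> = (\<lambda>i k (\<omega>, z). partial_deriv i (\<lambda>y. f i y z) (x k \<omega>) - partial_deriv i (J i) (x k \<omega>))"
  have \<epsilon>_\<Phi>: "\<epsilon> i k j \<omega> = \<Phi> i k (\<omega>, X i k j \<omega>)" for i k j \<omega>
    by (simp add: \<Phi>_def \<epsilon>_eq g_eq)
  have \<Phi>_meas: "\<Phi> i k \<in> borel_measurable (past M (x 0) m X k \<Otimes>\<^sub>M borel)" for i k
  proof -
    let ?N = "past M (x 0) m X k \<Otimes>\<^sub>M (borel :: real measure)"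
    have Y: "(\<lambda>p. x k (fst p)) \<in> borel_measurable ?N"
      using x_adapted[of k] by measurable
    have YC: "x k (fst p) \<in> ?C" if "p \<in> space ?N" for p
      using that x_in by (auto simp: space_pair_measure space_past)
    have "continuous_on ?C ?F"
      using lipschitz(2) by (rule lipschitz_on_continuous_on)
    then have "(\<lambda>y. ?F y $ i) \<in> borel_measurable (restrict_space borel ?C)"
      by (intro borel_measurable_continuous_on_restrict continuous_intros)
    then have "(\<lambda>p. ?F (x k (fst p)) $ i) \<in> borel_measurable ?N"
      by (rule measurable_compose[rotated]) (use Y YC in \<open>auto intro!: measurable_restrict_space2\<close>)
    then have "(\<lambda>p. partial_deriv i (J i) (x k (fst p))) \<in> borel_measurable ?N"
      by (simp add: pseudo_gradient_def)
    moreover have "(\<lambda>p. partial_deriv i (\<lambda>y. f i y (snd p)) (x k (fst p))) \<in> borel_measurable ?N"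
      by (rule sample_gradient[OF Y _ YC]) auto
    ultimately have "(\<lambda>p. partial_deriv i (\<lambda>y. f i y (snd p)) (x k (fst p)) - partial_deriv i (J i) (x k (fst p)))
        \<in> borel_measurable ?N"
      by measurable
    then show ?thesis
      by (simp add: \<Phi>_def case_prod_beta')
  qed
  have \<epsilon>_meas: "\<epsilon> i k j \<in> borel_measurable M" if "j \<in> {1..m k}" for i k j
  proof -
    have "(\<lambda>\<omega>. \<omega>) \<in> measurable M (past M (x 0) m X k)"
      using measurable_from_subalg[OF sub measurable_ident] by (simp add: id_def)
    then have "(\<lambda>\<omega>. (\<omega>, X i k j \<omega>)) \<in> measurable M (past M (x 0) m X k \<Otimes>\<^sub>M borel)"
      using X_meas[OF that] by (rule measurable_Pair)
    then show ?thesis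
      unfolding \<epsilon>_\<Phi>[abs_def] using \<Phi>_meas by (rule measurable_compose)
  qed

  define p where "p = (\<delta> - 1) / \<delta>"
  have p: "0 < p" "2 * p = 2 * (\<delta> - 1) / \<delta>"
    using \<open>1 < \<delta>\<close> by (auto simp: p_def)
  define \<eta> where "\<eta> = (\<lambda>k. 32 powr (1 / \<delta>) * \<nu> * real (s k) powr - p)"
  define bad where "bad = (\<lambda>i k. {\<omega> \<in> space M. nb k \<le> 2 * card {l \<in> {1..nb k}.
      \<eta> k < \<bar>1 / real (s k) * (\<Sum>j\<in>B i k l. \<epsilon> i k j \<omega>)\<bar>}})"
  have params: "\<forall>\<^sub>F k in sequentially. s k > 0 \<and> 16 * ln (real k + 1) \<le> real (nb k) \<and>
      real k powr \<beta> / (66 * ln (real k)) \<le> real (s k)"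
    by (rule block_parameters_eventually[OF \<open>\<beta> > 0\<close> \<open>c \<ge> 1\<close> m_eq \<gamma>_eq nb_eq s_eq])
  have bad_meas: "bad i k \<in> sets M" for i k
  proof -
    have "Measurable.pred M (\<lambda>\<omega>. nb k \<le> 2 * card {l \<in> {1..nb k}.
      \<eta> k < \<bar>1 / real (s k) * (\<Sum>j\<in>B i k l. \<epsilon> i k j \<omega>)\<bar>})"
      by (intro measurable_majority borel_measurable_times borel_measurable_sum
          borel_measurable_const \<epsilon>_meas) (erule (1) in_block)
    then show ?thesis
      unfolding bad_def by measurable
  qed
  have bad_prob: "prob (bad i k) \<le> (1 / 2) powr (real (nb k) / 2)" if "s k > 0" for i k
    unfolding bad_def \<epsilon>_\<Phi> \<eta>_def p_def
  proof (rule conditional_median_of_means_failure[OF \<open>1 < \<delta>\<close> \<open>\<delta> \<le> 2\<close> \<open>\<nu> > 0\<close> _ that nb_pos blocks sub sub'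
        past_indep measurable_step_sample sample_indep \<Phi>_meas])
    fix j assume "j \<in> {1..m k}"
    then show "AE \<omega> in M. real_cond_exp M (past M (x 0) m X k) (\<lambda>\<omega>. \<Phi> i k (\<omega>, X i k j \<omega>)) \<omega> = 0"
      "AE \<omega> in M. nn_cond_exp M (past M (x 0) m X k) (\<lambda>\<omega>. ennreal (\<bar>\<Phi> i k (\<omega>, X i k j \<omega>)\<bar> powr \<delta>)) \<omega>
        \<le> ennreal (\<nu> powr \<delta>)"
      using noise_mean[of j k i] noise_moment[of j k i] by (simp_all add: \<epsilon>_\<Phi>[abs_def])
  qed simp
  have "AE \<omega> in M. \<forall>\<^sub>F k in sequentially. \<omega> \<in> space M - bad i k" for i
  proof (rule borel_cantelli_AE1[OF bad_meas])
    show "summable (\<lambda>k. prob (bad i k))"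
    proof (rule failure_bound_summable[of nb])
      show "\<forall>\<^sub>F k in sequentially. 16 * ln (real k + 1) \<le> real (nb k)"
        using params by eventually_elim simp
      show "\<forall>\<^sub>F k in sequentially. prob (bad i k) \<le> (1 / 2) powr (real (nb k) / 2)"
        using params by eventually_elim (use bad_prob in simp)
    qed simp
  qed (simp add: less_top[symmetric])
  then have good: "AE \<omega> in M. \<forall>i\<in>UNIV. \<forall>\<^sub>F k in sequentially. \<omega> \<in> space M - bad i k"
    by (intro AE_finite_allI) auto

  define w where "w = (\<lambda>k::nat. (ln (real k) / real k powr \<beta>) powr p)"
  \<comment> \<open>The number of coordinates enters when the norm is bounded by the sum of the coordinate
    errors, and \<open>66 powr p\<close> comes from the lower bound on the block size.\<close>
  define E where "E = real CARD('n) * (32 powr (1 / \<delta>) * \<nu> * 66 powr p)"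
  have path: "\<exists>A>0. \<exists>K. \<forall>k\<ge>K. norm (x k \<omega> - xs) \<le> A * w k"
    if \<omega>: "\<omega> \<in> space M" and good: "\<forall>i. \<forall>\<^sub>F k in sequentially. \<omega> \<in> space M - bad i k"
      and vi: "solves_vi ?C ?F xs" for \<omega> xs
  proof -
    \<comment> \<open>the error of the estimated pseudo-gradient along one sample path\<close>
    define e where "e = (\<lambda>k. \<chi> i. ghat i k \<omega> - ?F (x k \<omega>) $ i)"
    have "\<forall>\<^sub>F k in sequentially. \<forall>i. \<omega> \<in> space M - bad i k"
      using good by (intro eventually_all_finite) blast
    then have noise: "\<forall>\<^sub>F k in sequentially. norm (e k) \<le> E * w k"
      using params eventually_ge_at_top[of 2]
    proof eventually_elim
      case (elim k)
      have "\<bar>ghat i k \<omega> - ?F (x k \<omega>) $ i\<bar> \<le> \<eta> k" for i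
        unfolding ghat_def
      proof (rule median_near)
        let ?mean = "\<lambda>l. 1 / real (s k) * (\<Sum>j\<in>B i k l. g i k j \<omega>)"
        \<comment> \<open>Centring every entry of the list at the exact derivative turns block means of sampled
          gradients into block means of errors.\<close>
        have shift: "?mean l - ?F (x k \<omega>) $ i = 1 / real (s k) * (\<Sum>j\<in>B i k l. \<epsilon> i k j \<omega>)"
          if "l \<in> {1..nb k}" for l
          using blocks(2)[OF that, of i] elim
          by (simp add: \<epsilon>_eq sum_subtractf pseudo_gradient_def field_simps)
        have "length (filter (\<lambda>u. \<eta> k < \<bar>u - ?F (x k \<omega>) $ i\<bar>) (map ?mean [1..<nb k + 1]))
            = length (filter (\<lambda>l. \<eta> k < \<bar>?mean l - ?F (x k \<omega>) $ i\<bar>) [1..<nb k + 1])"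
          by (simp add: filter_map comp_def)
        also have "\<dots> = card {l \<in> {1..nb k}. \<eta> k < \<bar>?mean l - ?F (x k \<omega>) $ i\<bar>}"
          by (subst distinct_card[symmetric]) (auto intro!: arg_cong[where f = card])
        also have "{l \<in> {1..nb k}. \<eta> k < \<bar>?mean l - ?F (x k \<omega>) $ i\<bar>} =
            {l \<in> {1..nb k}. \<eta> k < \<bar>1 / real (s k) * (\<Sum>j\<in>B i k l. \<epsilon> i k j \<omega>)\<bar>}"
          using shift by (intro Collect_cong conj_cong refl) metis
        finally show "2 * length (filter (\<lambda>u. \<eta> k < \<bar>u - ?F (x k \<omega>) $ i\<bar>) (map ?mean [1..<nb k + 1]))
            < length (map ?mean [1..<nb k + 1])"
          using elim(1) \<omega> by (simp add: bad_def not_le del: upt_Suc)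
      qed
      then have "norm (e k) \<le> real CARD('n) * \<eta> k"
        using norm_le_l1_cart[of "e k"] sum_bounded_above[of UNIV "\<lambda>i. \<bar>e k $ i\<bar>" "\<eta> k"]
        by (simp add: e_def)
      also have "\<dots> \<le> E * w k"
      proof -
        have ln: "ln (real k) > 0"
          using elim(3) by simp
        have "real (s k) powr - p \<le> (real k powr \<beta> / (66 * ln (real k))) powr - p"
          using elim ln p by (intro powr_mono2') auto
        also have "\<dots> = 66 powr p * w k"
          using elim(3) ln by (simp add: w_def powr_divide powr_mult powr_minus field_simps)
        finally show ?thesis
          using \<open>\<nu> > 0\<close> by (simp add: E_def \<eta>_def mult_left_mono mult.assoc)
      qed
      finally show ?case .
    qed
    show ?thesis
      unfolding w_def
    proof (rule projected_noisy_gradient_rate[OF C(1,2) vi x_in[OF \<omega>] strongly_monotone(2) lip \<open>b > 0\<close>])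
      show "x (Suc k) \<omega> = closest_point ?C (x k \<omega> - (b / (real k + 1)) *\<^sub>R (?F (x k \<omega>) + e k))" for k
      proof -
        have "(\<chi> i. ghat i k \<omega>) = ?F (x k \<omega>) + e k"
          by (simp add: e_def vec_eq_iff)
        then show ?thesis
          using step'[OF \<omega>] by (simp add: \<alpha>_eq)
      qed
      show "\<mu> * b > p * \<beta>"
      proof -
        have "p * \<beta> \<le> \<beta> * (2 * p)"
          using p(1) \<open>\<beta> > 0\<close> by simp
        then have "p * \<beta> \<le> \<beta> * (2 * (\<delta> - 1) / \<delta>)"
          unfolding p(2) .
        then show ?thesis
          using b_large by linarith
      qed
      show "\<forall>\<^sub>F k in sequentially. norm (e k) \<le> E * (ln (real k) / real k powr \<beta>) powr p"
        using noise unfolding w_def .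
    qed (use p \<open>\<beta> > 0\<close> \<open>\<nu> > 0\<close> in \<open>auto simp: E_def\<close>)
  qed

  have "AE \<omega> in M. \<exists>A3>0. \<exists>Kr::nat.
        (\<forall>k\<ge>Kr. (norm (x k \<omega> - xs))^2
            \<le> A3 * max (1 / real k) ((ln (real k) / real k powr \<beta>) powr (2 * (\<delta> - 1) / \<delta>))) \<and>
        (\<delta> = 2 \<and> \<beta> \<ge> 1 \<longrightarrow>
          (\<forall>k\<ge>Kr. (norm (x k \<omega> - xs))^2 \<le> A3 * (ln (real k) / real k)))"
    if "nash_equilibrium S J xs" for xs
    using good AE_space
  proof eventually_elim
    case (elim \<omega>)
    have "\<exists>A>0. \<exists>K. \<forall>k\<ge>K. norm (x k \<omega> - xs) \<le> A * w k"
      by (rule path) (use elim that nash_iff in auto)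
    then obtain A K where A: "A > 0" and K: "\<And>k. k \<ge> K \<Longrightarrow> norm (x k \<omega> - xs) \<le> A * w k"
      by blast
    have sq: "(norm (x k \<omega> - xs))^2 \<le> A^2 * (ln (real k) / real k powr \<beta>) powr (2 * (\<delta> - 1) / \<delta>)"
      if "k \<ge> K" for k
    proof -
      have "(norm (x k \<omega> - xs))^2 \<le> (A * w k)^2"
        using K[OF that] by (intro power_mono) auto
      also have "(w k)^2 = (ln (real k) / real k powr \<beta>) powr (2 * p)"
        by (simp add: w_def power2_eq_square flip: powr_add)
      then have "(A * w k)^2 = A^2 * (ln (real k) / real k powr \<beta>) powr (2 * (\<delta> - 1) / \<delta>)"
        by (simp add: power_mult_distrib p(2))
      finally show ?thesis .
    qed
    show ?case
    proof (intro exI[of _ "A^2"] exI[of _ "max K 2"] conjI allI impI)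
      show "A^2 > 0"
        using A by simp
      fix k assume k: "max K 2 \<le> k"
      have "A^2 * (ln (real k) / real k powr \<beta>) powr (2 * (\<delta> - 1) / \<delta>)
          \<le> A^2 * max (1 / real k) ((ln (real k) / real k powr \<beta>) powr (2 * (\<delta> - 1) / \<delta>))"
        by (intro mult_left_mono) auto
      then show "(norm (x k \<omega> - xs))^2
          \<le> A^2 * max (1 / real k) ((ln (real k) / real k powr \<beta>) powr (2 * (\<delta> - 1) / \<delta>))"
        using sq[of k] k by linarith
    next
      fix k assume \<delta>\<beta>: "\<delta> = 2 \<and> \<beta> \<ge> 1" and k: "max K 2 \<le> k"
      have "real k powr 1 \<le> real k powr \<beta>"
        using k \<delta>\<beta> by (intro powr_mono) auto
      then have "ln (real k) / real k powr \<beta> \<le> ln (real k) / real k"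
        using k by (intro divide_left_mono) auto
      then have "A^2 * (ln (real k) / real k powr \<beta>) \<le> A^2 * (ln (real k) / real k)"
        by (intro mult_left_mono) auto
      moreover have "(norm (x k \<omega> - xs))^2 \<le> A^2 * (ln (real k) / real k powr \<beta>)"
        using sq[of k] k \<delta>\<beta> by simp
      ultimately show "(norm (x k \<omega> - xs))^2 \<le> A^2 * (ln (real k) / real k)"
        by linarith
    qed
  qed
  then show ?thesis
    using unique by blast
qed

end
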